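(* Let $X$ be a separable, rearrangement invariant space over $\mathbb{N}_0$ and $t\in[0,1)$. The operator $\mathcal{C}_t\in\mathcal{L}(X)$ satisfies $\|\mathcal{C}_t\|_{X\to X}\le(1-t)^{-1}$, is compact and has spectrum $\sigma(\mathcal{C}_t;X)=\Lambda\cup\{0\}$. Moreover, the fine spectra of $\mathcal{C}_t$ are given by $$\sigma_{\mathrm p}(\mathcal{C}_t;X)=\Lambda,\quad \sigma_{\mathrm c}(\mathcal{C}_t;X)=\{0\},\quad \sigma_{\mathrm r}(\mathcal{C}_t;X)=\emptyset.$$
   Context: Let $\mathbb{N}_0=\{0,1,2,\dots\}$ and $\Lambda:=\{1/(n+1):n\in\mathbb{N}_0\}$. For $t\in[0,1]$ the generalized Cesàro operator on $\mathbb{C}^{\mathbb{N}_0}$ is $(\mathcal{C}_tx)_n=\frac{1}{n+1}\sum_{k=0}^n t^{n-k}x_k$ (with $0^0=1$); $\mathcal{C}_t\in\mathcal{L}(X)$ means that it maps $X$ continuously into itself, and its restriction to $X$ is also denoted $\mathcal{C}_t$. Let $\mu$ be counting measure on $\mathbb{N}_0$ and $\mathcal{M}^+=\{x\in\mathbb{C}^{\mathbb{N}_0}:x_n\ge0\ \forall n\}$. A function norm is a map $\rho:\mathcal{M}^+\to[0,\infty]$ such that, for all $f,g,f_n\in\mathcal{M}^+$, $a\ge0$, $E\subseteq\mathbb{N}_0$: (P1) $\rho(f)=0\iff f=0$, $\rho(af)=a\rho(f)$, $\rho(f+g)\le\rho(f)+\rho(g)$; (P2) $0\le g\le f\Rightarrow\rho(g)\le\rho(f)$;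 (P3) $0\le f_n\uparrow f$ pointwise $\Rightarrow\rho(f_n)\uparrow\rho(f)$; (P4) $\mu(E)<\infty\Rightarrow\rho(\chi_E)<\infty$; (P5) $\mu(E)<\infty\Rightarrow\sum_{n\in E}f_{(n)}\le C_E\,\rho(f)$ for some constant $0<C_E<\infty$ depending only on $E$ (and $\rho$), where $f_{(n)}$ denotes the $n$-th coordinate of $f$. The Banach function space on $\mathbb{N}_0$ given by $\rho$ is $X=\{x\in\mathbb{C}^{\mathbb{N}_0}:\rho(|x|)<\infty\}$, $|x|=(|x_n|)_n$, with norm $\|x\|_X=\rho(|x|)$. Elements $x,y\in\mathbb{C}^{\mathbb{N}_0}$ are equimeasurable if $\mu(\{n:|x_n|>\lambda\})=\mu(\{n:|y_n|>\lambda\})$ for all $\lambda\ge0$. A Banach function space $X$ on $\mathbb{N}_0$ is rearrangement invariant if $\|x\|_X=\|y\|_X$ whenever $x,y\in X$ are equimeasurable. $\mathcal{L}(X)$ is the space of continuous linear operators on $X$. For $T\in\mathcal{L}(X)$: $\sigma(T;X)$ is the set of $\lambda\in\mathbb{C}$ with $T-\lambda I$ not invertible in $\mathcal{L}(X)$; $\sigma_{\mathrm p}(T;X)$ is the set of $\lambda$ with $T-\lambda I$ not injective; $\sigma_{\mathrm c}(T;X)$ is the set of $\lambda$ with $T-\lambda I$ injective and range a proper dense subspace of $X$; $\sigma_{\mathrm r}(T;X)$ is the set of $\lambda$ with $T-\lambda I$ injective and range not dense in $X$. *)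

theory Defs
  imports "HOL-Analysis.Analysis"
begin

definition Mplus :: "(nat \<Rightarrow> real) set" where
  "Mplus = {f. \<forall>n. 0 \<le> f n}"

abbreviation counting :: "nat set \<Rightarrow> ennreal" where
  "counting E \<equiv> emeasure (count_space UNIV) E"

text \<open>Only the values of \<open>\<rho>\<close> on \<open>Mplus\<close> are constrained, and only those are ever used.\<close>

locale function_norm =
  fixes \<rho> :: "(nat \<Rightarrow> real) \<Rightarrow> ennreal"
  assumes P1_zero: "f \<in> Mplus \<Longrightarrow> \<rho> f = 0 \<longleftrightarrow> (\<forall>n. f n = 0)"
    and P1_scale: "f \<in> Mplus \<Longrightarrow> 0 \<le> a \<Longrightarrow> \<rho> (\<lambda>n. a * f n) = ennreal a * \<rho> f"
    and P1_triangle: "f \<in> Mplus \<Longrightarrow> g \<in> Mplus \<Longrightarrow> \<rho> (\<lambda>n. f n + g n) \<le> \<rho> f + \<rho> g"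
    and P2: "f \<in> Mplus \<Longrightarrow> g \<in> Mplus \<Longrightarrow> (\<forall>n. g n \<le> f n) \<Longrightarrow> \<rho> g \<le> \<rho> f"
    and P3: "(\<forall>k. F k \<in> Mplus) \<Longrightarrow> f \<in> Mplus \<Longrightarrow> (\<forall>n. incseq (\<lambda>k. F k n)) \<Longrightarrow>
               (\<forall>n. (\<lambda>k. F k n) \<longlonglongrightarrow> f n) \<Longrightarrow>
               incseq (\<lambda>k. \<rho> (F k)) \<and> (\<lambda>k. \<rho> (F k)) \<longlonglongrightarrow> \<rho> f"
    and P4: "counting E < \<infinity> \<Longrightarrow> \<rho> (indicator E) < \<infinity>"
    and P5: "counting E < \<infinity> \<Longrightarrow>
               \<exists>C>0. \<forall>f\<in>Mplus. ennreal (\<Sum>n\<in>E. f n) \<le> ennreal C * \<rho> f"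

definition bfs :: "((nat \<Rightarrow> real) \<Rightarrow> ennreal) \<Rightarrow> (nat \<Rightarrow> complex) set" where
  "bfs \<rho> = {x. \<rho> (\<lambda>n. cmod (x n)) < \<infinity>}"

definition bfs_norm :: "((nat \<Rightarrow> real) \<Rightarrow> ennreal) \<Rightarrow> (nat \<Rightarrow> complex) \<Rightarrow> real" where
  "bfs_norm \<rho> x = enn2real (\<rho> (\<lambda>n. cmod (x n)))"

definition bfs_dist :: "((nat \<Rightarrow> real) \<Rightarrow> ennreal) \<Rightarrow> (nat \<Rightarrow> complex) \<Rightarrow> (nat \<Rightarrow> complex) \<Rightarrow> real" where
  "bfs_dist \<rho> x y = bfs_norm \<rho> (\<lambda>n. x n - y n)"

definition bfs_top :: "((nat \<Rightarrow> real) \<Rightarrow> ennreal) \<Rightarrow> (nat \<Rightarrow> complex) topology" where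
  "bfs_top \<rho> = Metric_space.mtopology (bfs \<rho>) (bfs_dist \<rho>)"

definition equimeasurable :: "(nat \<Rightarrow> complex) \<Rightarrow> (nat \<Rightarrow> complex) \<Rightarrow> bool" where
  "equimeasurable x y \<longleftrightarrow>
     (\<forall>l\<ge>0. counting {n. cmod (x n) > l} = counting {n. cmod (y n) > l})"

definition rearrangement_invariant :: "((nat \<Rightarrow> real) \<Rightarrow> ennreal) \<Rightarrow> bool" where
  "rearrangement_invariant \<rho> \<longleftrightarrow>
     (\<forall>x\<in>bfs \<rho>. \<forall>y\<in>bfs \<rho>. equimeasurable x y \<longrightarrow> bfs_norm \<rho> x = bfs_norm \<rho> y)"

text \<open>Operators on the space are total functions on sequences, of which only the restriction to
  \<open>bfs \<rho>\<close> matters.\<close>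

definition bounded_ops ::
    "((nat \<Rightarrow> real) \<Rightarrow> ennreal) \<Rightarrow> ((nat \<Rightarrow> complex) \<Rightarrow> nat \<Rightarrow> complex) set" where
  "bounded_ops \<rho> = {T.
     (\<forall>x\<in>bfs \<rho>. \<forall>y\<in>bfs \<rho>. T (\<lambda>n. x n + y n) = (\<lambda>n. T x n + T y n)) \<and>
     (\<forall>x\<in>bfs \<rho>. \<forall>a. T (\<lambda>n. a * x n) = (\<lambda>n. a * T x n)) \<and>
     continuous_map (bfs_top \<rho>) (bfs_top \<rho>) T}"

text \<open>The operator norm is taken in \<open>ennreal\<close>, so that the supremum is meaningful without a
  separate proof of boundedness.\<close>

definition op_norm ::
    "((nat \<Rightarrow> real) \<Rightarrow> ennreal) \<Rightarrow> ((nat \<Rightarrow> complex) \<Rightarrow> nat \<Rightarrow> complex) \<Rightarrow> ennreal" where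
  "op_norm \<rho> T = (SUP x\<in>{x \<in> bfs \<rho>. bfs_norm \<rho> x \<le> 1}. \<rho> (\<lambda>n. cmod (T x n)))"

definition compact_op ::
    "((nat \<Rightarrow> real) \<Rightarrow> ennreal) \<Rightarrow> ((nat \<Rightarrow> complex) \<Rightarrow> nat \<Rightarrow> complex) \<Rightarrow> bool" where
  "compact_op \<rho> T \<longleftrightarrow> T \<in> bounded_ops \<rho> \<and>
     compactin (bfs_top \<rho>) (bfs_top \<rho> closure_of (T ` {x \<in> bfs \<rho>. bfs_norm \<rho> x \<le> 1}))"

definition shifted ::
    "((nat \<Rightarrow> complex) \<Rightarrow> nat \<Rightarrow> complex) \<Rightarrow> complex \<Rightarrow> (nat \<Rightarrow> complex) \<Rightarrow> nat \<Rightarrow> complex" where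
  "shifted T l x = (\<lambda>n. T x n - l * x n)"

definition spectrum ::
    "((nat \<Rightarrow> real) \<Rightarrow> ennreal) \<Rightarrow> ((nat \<Rightarrow> complex) \<Rightarrow> nat \<Rightarrow> complex) \<Rightarrow> complex set" where
  "spectrum \<rho> T = {l. \<not> (\<exists>S\<in>bounded_ops \<rho>. \<forall>x\<in>bfs \<rho>.
     S (shifted T l x) = x \<and> shifted T l (S x) = x)}"

definition point_spectrum ::
    "((nat \<Rightarrow> real) \<Rightarrow> ennreal) \<Rightarrow> ((nat \<Rightarrow> complex) \<Rightarrow> nat \<Rightarrow> complex) \<Rightarrow> complex set" where
  "point_spectrum \<rho> T = {l. \<not> inj_on (shifted T l) (bfs \<rho>)}"

definition continuous_spectrum ::
    "((nat \<Rightarrow> real) \<Rightarrow> ennreal) \<Rightarrow> ((nat \<Rightarrow> complex) \<Rightarrow> nat \<Rightarrow> complex) \<Rightarrow> complex set" where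
  "continuous_spectrum \<rho> T = {l. inj_on (shifted T l) (bfs \<rho>) \<and>
     shifted T l ` bfs \<rho> \<noteq> bfs \<rho> \<and>
     bfs_top \<rho> closure_of (shifted T l ` bfs \<rho>) = bfs \<rho>}"

definition residual_spectrum ::
    "((nat \<Rightarrow> real) \<Rightarrow> ennreal) \<Rightarrow> ((nat \<Rightarrow> complex) \<Rightarrow> nat \<Rightarrow> complex) \<Rightarrow> complex set" where
  "residual_spectrum \<rho> T = {l. inj_on (shifted T l) (bfs \<rho>) \<and>
     bfs_top \<rho> closure_of (shifted T l ` bfs \<rho>) \<noteq> bfs \<rho>}"

definition cesaro :: "real \<Rightarrow> (nat \<Rightarrow> complex) \<Rightarrow> nat \<Rightarrow> complex" where
  "cesaro t x = (\<lambda>n. 1 / of_nat (n + 1) * (\<Sum>k=0..n. of_real t ^ (n - k) * x k))"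

definition Lambda :: "complex set" where
  "Lambda = {1 / of_nat (n + 1) | n. True}"

context function_norm
begin

lemma abs_Mplus: "(\<lambda>n. cmod (x n)) \<in> Mplus"
  by (simp add: Mplus_def)

lemma rho_cmod_add:
  "\<rho> (\<lambda>n. cmod (x n + y n)) \<le> \<rho> (\<lambda>n. cmod (x n)) + \<rho> (\<lambda>n. cmod (y n))"
proof -
  have "\<rho> (\<lambda>n. cmod (x n + y n)) \<le> \<rho> (\<lambda>n. cmod (x n) + cmod (y n))"
    by (rule P2) (auto simp: Mplus_def norm_triangle_ineq)
  also have "\<dots> \<le> \<rho> (\<lambda>n. cmod (x n)) + \<rho> (\<lambda>n. cmod (y n))"
    by (rule P1_triangle) (auto simp: Mplus_def)
  finally show ?thesis .
qed

lemma bfs_add: "x \<in> bfs \<rho> \<Longrightarrow> y \<in> bfs \<rho> \<Longrightarrow> (\<lambda>n. x n + y n) \<in> bfs \<rho>"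
  using le_less_trans[OF rho_cmod_add] by (auto simp: bfs_def)

lemma bfs_scale: "x \<in> bfs \<rho> \<Longrightarrow> (\<lambda>n. a * x n) \<in> bfs \<rho>"
  using P1_scale[OF abs_Mplus[of x], of "cmod a"]
  by (simp add: bfs_def norm_mult ennreal_mult_less_top)

lemma bfs_diff: "x \<in> bfs \<rho> \<Longrightarrow> y \<in> bfs \<rho> \<Longrightarrow> (\<lambda>n. x n - y n) \<in> bfs \<rho>"
  using bfs_add[of x "\<lambda>n. -1 * y n"] bfs_scale[of y "-1"] by simp

lemma bfs_norm_add:
  assumes "x \<in> bfs \<rho>" "y \<in> bfs \<rho>"
  shows "bfs_norm \<rho> (\<lambda>n. x n + y n) \<le> bfs_norm \<rho> x + bfs_norm \<rho> y"
proof -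
  have "bfs_norm \<rho> (\<lambda>n. x n + y n) \<le> enn2real (\<rho> (\<lambda>n. cmod (x n)) + \<rho> (\<lambda>n. cmod (y n)))"
    unfolding bfs_norm_def using assms
    by (intro enn2real_mono rho_cmod_add) (auto simp: bfs_def)
  also have "\<dots> = bfs_norm \<rho> x + bfs_norm \<rho> y"
    unfolding bfs_norm_def using assms by (intro enn2real_plus) (auto simp: bfs_def)
  finally show ?thesis .
qed

lemma bfs_norm_eq_0: "x \<in> bfs \<rho> \<Longrightarrow> bfs_norm \<rho> x = 0 \<longleftrightarrow> x = (\<lambda>_. 0)"
  using P1_zero[OF abs_Mplus[of x]]
  by (auto simp: bfs_norm_def bfs_def enn2real_eq_0_iff fun_eq_iff)

lemma Metric_space_bfs: "Metric_space (bfs \<rho>) (bfs_dist \<rho>)"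
proof
  fix x y z
  show "0 \<le> bfs_dist \<rho> x y"
    by (simp add: bfs_dist_def bfs_norm_def)
  show "bfs_dist \<rho> x y = bfs_dist \<rho> y x"
    by (simp add: bfs_dist_def bfs_norm_def norm_minus_commute)
  assume xy: "x \<in> bfs \<rho>" "y \<in> bfs \<rho>"
  show "bfs_dist \<rho> x y = 0 \<longleftrightarrow> x = y"
    using bfs_norm_eq_0[OF bfs_diff[OF xy]] by (auto simp: bfs_dist_def fun_eq_iff)
  assume z: "z \<in> bfs \<rho>"
  show "bfs_dist \<rho> x z \<le> bfs_dist \<rho> x y + bfs_dist \<rho> y z"
    using bfs_norm_add[OF bfs_diff[OF xy] bfs_diff[OF xy(2) z]] by (simp add: bfs_dist_def)
qed

lemma topspace_bfs_top [simp]: "topspace (bfs_top \<rho>) = bfs \<rho>"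
  unfolding bfs_top_def using Metric_space.topspace_mtopology[OF Metric_space_bfs] .

end

end

theory Submission
  imports Defs
begin

text \<open>Write \<open>S\<close> for the right shift, \<open>D\<close> for the diagonal operator with entries \<open>1/(n+1)\<close> and
  \<open>R = I + t S + t\<^sup>2 S\<^sup>2 + \<dots>\<close>, the inverse of \<open>I - t S\<close>. The generalized Cesaro operator is
  \<open>D R\<close>, and everything follows from this factorisation.

  A sequence and its shift are equimeasurable, so by rearrangement invariance \<open>S\<close> has norm at most
  one and \<open>R\<close> has norm at most \<open>1/(1-t)\<close> (\<open>rho_geo_le\<close>); the entries of \<open>D\<close> are at most one. Since
  they tend to \<open>0\<close>, the images of the unit ball have uniformly small tails (\<open>cesaro_tail\<close>). The unit
  ball is compact for coordinatewise convergence, by Tychonoff and Fatou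
  (\<open>unit_ball_coordinatewise_compact\<close>), and the two facts together give compactness of the operator
  (\<open>cesaro_compact\<close>).

  For the spectra, substitute \<open>y = R z\<close> in \<open>(D R - l) z = x\<close>. The result is the bidiagonal system
  \<open>(D - l (I - t S)) y = x\<close>, solvable by forward substitution for all sequences \<open>x\<close> exactly when \<open>l\<close>
  is not one of the diagonal entries \<open>1/(n+1)\<close>. If moreover \<open>l \<noteq> 0\<close>, then the ratio of the recursion tends
  in modulus to \<open>t < 1\<close>, so the solution operator is dominated by a convergent geometric series in
  \<open>S\<close> and is bounded (\<open>resolvent_bounded_op\<close>). For \<open>l = 1/(m+1)\<close> the sequence with entries
  \<open>(n choose m) * t ^ (n - m)\<close> is an eigenvector in the space. For \<open>l = 0\<close> the operator is injective; its
  range contains all finitely supported sequences, which are dense because separability makes the tails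
  of every element small (\<open>order_continuous_norm_if_separable\<close>); and the range is not everything,
  because \<open>x\<close> in the range forces \<open>(n+1) x n\<close> to be bounded (\<open>cesaro_not_surj\<close>).\<close>

section \<open>The factorisation of the operator\<close>

definition shift :: "(nat \<Rightarrow> 'a::zero) \<Rightarrow> nat \<Rightarrow> 'a" where
  "shift x n = (case n of 0 \<Rightarrow> 0 | Suc m \<Rightarrow> x m)"

lemma shift_0 [simp]: "shift x 0 = 0" and shift_Suc [simp]: "shift x (Suc n) = x n"
  by (simp_all add: shift_def)

text \<open>The operator \<open>\<Sum>\<^sub>j q\<^sup>j S\<^sup>j\<close>, inverse to \<open>I - q S\<close>, where \<open>S\<close> is the right shift. The recursion is
  the equation \<open>g = x + q S g\<close>, the form in which all later estimates use it; \<open>geo_eq_sum\<close> gives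
  the closed form.\<close>

primrec geo :: "'a::comm_ring_1 \<Rightarrow> (nat \<Rightarrow> 'a) \<Rightarrow> nat \<Rightarrow> 'a" where
  "geo q x 0 = x 0"
| "geo q x (Suc n) = x (Suc n) + q * geo q x n"

definition ungeo :: "'a::comm_ring_1 \<Rightarrow> (nat \<Rightarrow> 'a) \<Rightarrow> nat \<Rightarrow> 'a" where
  "ungeo q y n = y n - q * shift y n"

lemma geo_ungeo [simp]: "geo q (ungeo q y) = y"
proof
  show "geo q (ungeo q y) n = y n" for n
    by (induction n) (simp_all add: ungeo_def)
qed

lemma ungeo_geo [simp]: "ungeo q (geo q x) = x"
proof
  show "ungeo q (geo q x) n = x n" for n
    by (cases n) (simp_all add: ungeo_def)
qed

lemma geo_add: "geo q (\<lambda>n. x n + y n) n = geo q x n + geo q y n"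
  by (induction n) (simp_all add: algebra_simps)

lemma geo_scale: "geo q (\<lambda>n. a * x n) n = a * geo q x n"
  by (induction n) (simp_all add: algebra_simps)

lemma geo_eq_sum: "geo q x n = (\<Sum>k=0..n. q ^ (n - k) * x k)"
proof (induction n)
  case (Suc n)
  have "(\<Sum>k=0..Suc n. q ^ (Suc n - k) * x k) = (\<Sum>k=0..n. q * (q ^ (n - k) * x k)) + x (Suc n)"
    by (auto simp: Suc_diff_le mult.assoc intro!: sum.cong)
  then show ?case
    by (simp add: Suc sum_distrib_left)
qed simp

lemma norm_geo_le:
  fixes x :: "nat \<Rightarrow> 'a::real_normed_field"
  shows "norm (geo q x n) \<le> geo (norm q) (\<lambda>k. norm (x k)) n"
proof (induction n)
  case (Suc n)
  have "norm (geo q x (Suc n)) \<le> norm (x (Suc n)) + norm q * norm (geo q x n)"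
    by (metis geo.simps(2) norm_mult norm_triangle_ineq)
  also have "\<dots> \<le> norm (x (Suc n)) + norm q * geo (norm q) (\<lambda>k. norm (x k)) n"
    by (intro add_left_mono mult_left_mono Suc) simp
  finally show ?case by simp
qed simp

text \<open>The generalized Cesaro operator is the diagonal operator \<open>1/(n+1)\<close> applied after \<open>geo t\<close>.
  Solving an equation for \<open>cesaro t x\<close> therefore becomes a first-order recursion for \<open>geo t x\<close>.\<close>

lemma cesaro_eq_geo: "cesaro t x n = geo (of_real t) x n / of_nat (n + 1)"
  unfolding cesaro_def geo_eq_sum by simp

lemma cesaro_add: "cesaro t (\<lambda>n. x n + y n) = (\<lambda>n. cesaro t x n + cesaro t y n)"
  by (simp add: cesaro_eq_geo geo_add add_divide_distrib fun_eq_iff)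

lemma cesaro_scale: "cesaro t (\<lambda>n. a * x n) = (\<lambda>n. a * cesaro t x n)"
  by (simp add: cesaro_eq_geo geo_scale fun_eq_iff)

lemma cesaro_diff: "cesaro t (\<lambda>n. x n - y n) = (\<lambda>n. cesaro t x n - cesaro t y n)"
  using cesaro_add[of t x "\<lambda>n. - 1 * y n"] cesaro_scale[of t "-1" y] by simp

definition trunc :: "nat \<Rightarrow> (nat \<Rightarrow> 'a::zero) \<Rightarrow> nat \<Rightarrow> 'a" where
  "trunc N x n = (if n < N then x n else 0)"

lemma geo_nonneg: "0 \<le> (q::real) \<Longrightarrow> f \<in> Mplus \<Longrightarrow> geo q f \<in> Mplus"
proof -
  assume "0 \<le> q" "f \<in> Mplus"
  then have "0 \<le> geo q f n" for n
    by (induction n) (simp_all add: Mplus_def)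
  then show ?thesis by (simp add: Mplus_def)
qed

lemma trunc_Mplus: "f \<in> Mplus \<Longrightarrow> trunc N f \<in> Mplus"
  by (simp add: Mplus_def trunc_def)

lemma shift_Mplus: "f \<in> Mplus \<Longrightarrow> shift f \<in> Mplus"
  by (simp add: Mplus_def shift_def split: nat.split)

lemma indicator_Mplus: "indicator E \<in> Mplus"
  by (simp add: Mplus_def)

section \<open>Function norms and coordinatewise convergence\<close>

context function_norm
begin

lemma bfs_iff: "x \<in> bfs \<rho> \<longleftrightarrow> \<rho> (\<lambda>n. cmod (x n)) < \<infinity>"
  by (simp add: bfs_def)

lemma rho_eq_bfs_norm: "x \<in> bfs \<rho> \<Longrightarrow> \<rho> (\<lambda>n. cmod (x n)) = ennreal (bfs_norm \<rho> x)"
  by (simp add: bfs_iff bfs_norm_def)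

lemma bfs_norm_nonneg [simp]: "0 \<le> bfs_norm \<rho> x"
  by (simp add: bfs_norm_def)

lemma bfs_normI:
  assumes "\<rho> (\<lambda>n. cmod (x n)) \<le> ennreal c" "0 \<le> c"
  shows "x \<in> bfs \<rho>" "bfs_norm \<rho> x \<le> c"
proof -
  show "x \<in> bfs \<rho>"
    using assms(1) by (auto simp: bfs_iff top_unique less_top[symmetric])
  then show "bfs_norm \<rho> x \<le> c"
    using assms rho_eq_bfs_norm[of x] by simp
qed

lemma bfs_norm_mono:
  assumes "y \<in> bfs \<rho>" "\<And>n. cmod (x n) \<le> cmod (y n)"
  shows "x \<in> bfs \<rho>" "bfs_norm \<rho> x \<le> bfs_norm \<rho> y"
proof -
  have "\<rho> (\<lambda>n. cmod (x n)) \<le> \<rho> (\<lambda>n. cmod (y n))"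
    by (rule P2) (use assms abs_Mplus in auto)
  also have "\<dots> = ennreal (bfs_norm \<rho> y)"
    by (rule rho_eq_bfs_norm) fact
  finally have "\<rho> (\<lambda>n. cmod (x n)) \<le> ennreal (bfs_norm \<rho> y)" .
  then show "x \<in> bfs \<rho>" "bfs_norm \<rho> x \<le> bfs_norm \<rho> y"
    by (auto intro: bfs_normI)
qed

lemma rho_zero: "\<rho> (\<lambda>_. 0) = 0"
  using P1_zero[of "\<lambda>_. 0"] by (simp add: Mplus_def)

lemma rho_trunc_mono: "f \<in> Mplus \<Longrightarrow> \<rho> (trunc N f) \<le> \<rho> f"
  by (rule P2) (auto simp: trunc_Mplus, auto simp: trunc_def Mplus_def)

text \<open>The Fatou axiom applied to truncations: a bound on a norm need only be proved for finitely
  supported functions, where every norm is finite and induction on the length is available.\<close>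

lemma rho_le_if_trunc_le:
  assumes "f \<in> Mplus" "\<And>N. \<rho> (trunc N f) \<le> c"
  shows "\<rho> f \<le> c"
proof -
  have "(\<lambda>N. trunc N f n) \<longlonglongrightarrow> f n" for n
    by (rule tendsto_eventually)
       (auto simp: trunc_def eventually_sequentially intro!: exI[of _ "Suc n"])
  moreover have "incseq (\<lambda>N. trunc N f n)" for n
    using assms(1) by (auto simp: incseq_def trunc_def Mplus_def)
  ultimately have "(\<lambda>N. \<rho> (trunc N f)) \<longlonglongrightarrow> \<rho> f"
    using P3[of "\<lambda>N. trunc N f" f] assms(1) by (simp add: trunc_Mplus)
  then show ?thesis
    by (rule LIMSEQ_le_const2) (use assms(2) in auto)
qed

lemma rho_unit_finite: "\<rho> (indicator {n}) < \<infinity>"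
  by (rule P4) simp

lemma rho_unit_pos: "0 < \<rho> (indicator {n})"
  using P1_zero[OF indicator_Mplus, of "{n}"] by (auto simp: zero_less_iff_neq_zero indicator_def)

text \<open>The unit vectors have positive finite norm, so each coordinate functional is continuous; its
  constant is \<open>1/u\<close>, by \<open>coord_le_rho\<close>.\<close>

lemma rho_unit_real: "\<exists>u>0. \<rho> (indicator {n}) = ennreal u"
proof (intro exI conjI)
  show "\<rho> (indicator {n}) = ennreal (enn2real (\<rho> (indicator {n})))"
    using rho_unit_finite[of n] by simp
  then show "0 < enn2real (\<rho> (indicator {n}))"
    using rho_unit_finite[of n] rho_unit_pos[of n] by (simp add: enn2real_positive_iff)
qed

lemma coord_le_rho:
  assumes "f \<in> Mplus"
  shows "ennreal (f n) * \<rho> (indicator {n}) \<le> \<rho> f"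
proof -
  have "\<rho> (\<lambda>k. f n * indicator {n} k) = ennreal (f n) * \<rho> (indicator {n})"
    using assms by (intro P1_scale indicator_Mplus) (simp add: Mplus_def)
  moreover have "\<rho> (\<lambda>k. f n * indicator {n} k) \<le> \<rho> f"
    using assms by (intro P2) (auto simp: Mplus_def indicator_def)
  ultimately show ?thesis by simp
qed

lemma rho_trunc_le_sum:
  assumes "f \<in> Mplus"
  shows "\<rho> (trunc N f) \<le> (\<Sum>n<N. ennreal (f n) * \<rho> (indicator {n}))"
proof (induction N)
  case 0
  then show ?case using rho_zero by (simp add: trunc_def[abs_def])
next
  case (Suc N)
  have "trunc (Suc N) f = (\<lambda>n. trunc N f n + f N * indicator {N} n)"
    by (auto simp: trunc_def fun_eq_iff indicator_def less_Suc_eq)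
  then have "\<rho> (trunc (Suc N) f) \<le> \<rho> (trunc N f) + \<rho> (\<lambda>n. f N * indicator {N} n)"
    using assms P1_triangle[of "trunc N f" "\<lambda>n. f N * indicator {N} n"]
    by (simp add: trunc_Mplus) (simp add: Mplus_def)
  also have "\<rho> (\<lambda>n. f N * indicator {N} n) = ennreal (f N) * \<rho> (indicator {N})"
    using assms by (intro P1_scale indicator_Mplus) (simp add: Mplus_def)
  also have "\<rho> (trunc N f) + ennreal (f N) * \<rho> (indicator {N})
      \<le> (\<Sum>n<Suc N. ennreal (f n) * \<rho> (indicator {n}))"
    using Suc by (simp add: add_right_mono)
  finally show ?case .
qed

lemma rho_trunc_finite: "f \<in> Mplus \<Longrightarrow> \<rho> (trunc N f) < \<infinity>"
  by (rule le_less_trans[OF rho_trunc_le_sum])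
     (use rho_unit_finite in \<open>auto simp: ennreal_mult_less_top\<close>)

lemma trunc_bfs: "trunc N x \<in> bfs \<rho>"
proof -
  have "(\<lambda>n. cmod (trunc N x n)) = trunc N (\<lambda>n. cmod (x n))"
    by (simp add: trunc_def fun_eq_iff)
  then show ?thesis
    using rho_trunc_finite[OF abs_Mplus, of N x] by (simp add: bfs_iff)
qed

lemma rho_trunc_tendsto_0:
  assumes "\<And>k. F k \<in> Mplus" "\<And>n. (\<lambda>k. F k n) \<longlonglongrightarrow> 0"
  shows "(\<lambda>k. \<rho> (trunc N (F k))) \<longlonglongrightarrow> 0"
proof (rule tendsto_sandwich[of "\<lambda>_. 0"])
  have "\<rho> (indicator {n}) \<noteq> top" for n
    using rho_unit_finite[of n] by simp
  then have "(\<lambda>k. \<Sum>n<N. ennreal (F k n) * \<rho> (indicator {n})) \<longlonglongrightarrow> (\<Sum>n<N. ennreal 0 * \<rho> (indicator {n}))"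
    by (intro tendsto_sum tendsto_mult_ennreal tendsto_ennrealI assms tendsto_const) auto
  then show "(\<lambda>k. \<Sum>n<N. ennreal (F k n) * \<rho> (indicator {n})) \<longlonglongrightarrow> 0"
    by simp
qed (use rho_trunc_le_sum[OF assms(1)] in auto)

text \<open>Fatou's lemma. On a fixed truncation, the limit differs from the \<open>k\<close>-th function by a finitely
  supported error that tends to \<open>0\<close> coordinatewise and hence in norm.\<close>

lemma rho_le_if_pointwise_limit:
  assumes "\<And>k. F k \<in> Mplus" "\<And>n. (\<lambda>k. F k n) \<longlonglongrightarrow> f n" "\<And>k. \<rho> (F k) \<le> c"
  shows "\<rho> f \<le> c"
proof (rule rho_le_if_trunc_le)
  show f: "f \<in> Mplus"
    using assms(1) LIMSEQ_le_const[OF assms(2)] by (auto simp: Mplus_def)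
  fix N
  define G where "G k n = \<bar>f n - F k n\<bar>" for k n
  have G: "G k \<in> Mplus" for k
    by (simp add: G_def Mplus_def)
  have "(\<lambda>k. G k n) \<longlonglongrightarrow> 0" for n
    unfolding G_def
    by (intro tendsto_rabs_zero tendsto_diff[OF tendsto_const[of "f n"] assms(2)[of n], simplified])
  then have "(\<lambda>k. c + \<rho> (trunc N (G k))) \<longlonglongrightarrow> c + 0"
    by (intro tendsto_add tendsto_const rho_trunc_tendsto_0 G)
  moreover have "\<rho> (trunc N f) \<le> c + \<rho> (trunc N (G k))" for k
  proof -
    have "\<rho> (trunc N f) \<le> \<rho> (\<lambda>n. F k n + trunc N (G k) n)"
      using f assms(1)[of k] trunc_Mplus[OF G, of N k]
      by (intro P2) (auto simp: Mplus_def trunc_def G_def)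
    also have "\<dots> \<le> \<rho> (F k) + \<rho> (trunc N (G k))"
      by (intro P1_triangle assms trunc_Mplus G)
    finally show ?thesis
      using assms(3)[of k] by (meson add_right_mono order_trans)
  qed
  ultimately show "\<rho> (trunc N f) \<le> c"
    by (auto intro: LIMSEQ_le_const)
qed

lemma bounded_opsI:
  assumes add: "\<And>x y. x \<in> bfs \<rho> \<Longrightarrow> y \<in> bfs \<rho> \<Longrightarrow> T (\<lambda>n. x n + y n) = (\<lambda>n. T x n + T y n)"
    and scale: "\<And>x a. x \<in> bfs \<rho> \<Longrightarrow> T (\<lambda>n. a * x n) = (\<lambda>n. a * T x n)"
    and bound: "\<And>x. x \<in> bfs \<rho> \<Longrightarrow> T x \<in> bfs \<rho> \<and> bfs_norm \<rho> (T x) \<le> C * bfs_norm \<rho> x"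
    and "0 \<le> C"
  shows "T \<in> bounded_ops \<rho>"
proof -
  have diff: "T (\<lambda>n. x n - y n) = (\<lambda>n. T x n - T y n)" if "x \<in> bfs \<rho>" "y \<in> bfs \<rho>" for x y
    using add[OF that(1) bfs_scale[OF that(2), of "-1"]] scale[OF that(2), of "-1"] by simp
  have "continuous_map (bfs_top \<rho>) (bfs_top \<rho>) T"
    unfolding bfs_top_def Metric_space.metric_continuous_map[OF Metric_space_bfs Metric_space_bfs]
  proof (intro conjI ballI allI impI)
    show "T ` bfs \<rho> \<subseteq> bfs \<rho>"
      using bound by auto
    fix x and e :: real
    assume x: "x \<in> bfs \<rho>" and "0 < e"
    have "bfs_dist \<rho> (T x) (T y) < e" if y: "y \<in> bfs \<rho>" "bfs_dist \<rho> x y < e / (C + 1)" for y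
    proof -
      have "bfs_dist \<rho> (T x) (T y) \<le> C * bfs_dist \<rho> x y"
        using bound[OF bfs_diff[OF x y(1)]] diff[OF x y(1)] by (simp add: bfs_dist_def)
      also have "\<dots> \<le> (C + 1) * bfs_dist \<rho> x y"
        by (simp add: bfs_dist_def mult_right_mono)
      also have "\<dots> < e"
        using y(2) \<open>0 \<le> C\<close> by (simp add: field_simps)
      finally show ?thesis .
    qed
    moreover have "0 < e / (C + 1)"
      using \<open>0 < e\<close> \<open>0 \<le> C\<close> by simp
    ultimately show "\<exists>d>0. \<forall>y. y \<in> bfs \<rho> \<and> bfs_dist \<rho> x y < d \<longrightarrow> bfs_dist \<rho> (T x) (T y) < e"
      by blast
  qed
  then show ?thesis
    using add scale by (simp add: bounded_ops_def)
qed

lemma bounded_ops_maps: "T \<in> bounded_ops \<rho> \<Longrightarrow> x \<in> bfs \<rho> \<Longrightarrow> T x \<in> bfs \<rho>"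
  unfolding bounded_ops_def using continuous_map_image_subset_topspace[of "bfs_top \<rho>" "bfs_top \<rho>" T]
  by auto

text \<open>The coordinates of vectors in the unit ball lie in fixed discs, so the ball sits inside a
  compact product of discs, which is metrizable; Fatou's lemma keeps the limit in the ball.\<close>

lemma unit_ball_coordinatewise_compact:
  fixes X :: "nat \<Rightarrow> nat \<Rightarrow> complex"
  assumes "\<And>k. X k \<in> bfs \<rho>" "\<And>k. bfs_norm \<rho> (X k) \<le> 1"
  shows "\<exists>r x. strict_mono r \<and> x \<in> bfs \<rho> \<and> bfs_norm \<rho> x \<le> 1 \<and>
    (\<forall>n. (\<lambda>k. X (r k) n) \<longlonglongrightarrow> x n)"
proof -
  define c where "c n = 1 / enn2real (\<rho> (indicator {n}))" for n
  have rho_le: "\<rho> (\<lambda>n. cmod (X k n)) \<le> 1" for k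
    using assms(2)[of k] rho_eq_bfs_norm[OF assms(1)[of k]] by (simp add: ennreal_le_1)
  have le_c: "cmod (X k n) \<le> c n" for k n
  proof -
    obtain u where u: "\<rho> (indicator {n}) = ennreal u" and "0 < u"
      using rho_unit_real by blast
    have "ennreal (cmod (X k n)) * ennreal u \<le> 1"
      using coord_le_rho[OF abs_Mplus, of "X k" n] rho_le[of k] u by (simp add: order_trans)
    then have "cmod (X k n) * u \<le> 1"
      using \<open>0 < u\<close> by (simp add: ennreal_mult[symmetric] ennreal_le_1)
    then show ?thesis
      using u \<open>0 < u\<close> by (simp add: c_def field_simps)
  qed
  have "compactin (product_topology (\<lambda>n. euclidean) UNIV) (\<Pi>\<^sub>E n\<in>UNIV. cball (0::complex) (c n))"
    by (subst compactin_PiE) auto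
  then have "compact (\<Pi>\<^sub>E n\<in>UNIV. cball (0::complex) (c n))"
    by (simp add: euclidean_product_topology)
  then have sc: "seq_compact (\<Pi>\<^sub>E n\<in>UNIV. cball (0::complex) (c n))"
    by (rule compact_imp_seq_compact)
  have "\<forall>k. X k \<in> (\<Pi>\<^sub>E n\<in>UNIV. cball (0::complex) (c n))"
    using le_c by auto
  then obtain x r where r: "strict_mono r" "(X \<circ> r) \<longlonglongrightarrow> x"
    by (rule seq_compactE[OF sc])
  have lim: "(\<lambda>k. X (r k) n) \<longlonglongrightarrow> x n" for n
    using continuous_on_tendsto_compose[OF continuous_on_product_coordinates[of n] r(2)]
    by (simp add: o_def)
  have "\<rho> (\<lambda>n. cmod (x n)) \<le> 1"
    by (rule rho_le_if_pointwise_limit[of "\<lambda>k n. cmod (X (r k) n)"])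
       (use abs_Mplus rho_le lim in \<open>auto intro: tendsto_norm\<close>)
  then have "x \<in> bfs \<rho>" "bfs_norm \<rho> x \<le> 1"
    using bfs_normI[of x 1] by auto
  with r(1) lim show ?thesis by blast
qed

text \<open>Separability forces the tails of every element to vanish in norm. If they did not, some
  \<open>x\<close> would have infinitely many disjoint blocks of coordinates, each of norm at least \<open>e/2\<close>.
  Restricting \<open>x\<close> to unions of blocks gives one element for every set of natural numbers, and
  these uncountably many elements are pairwise at distance at least \<open>e/2\<close>.\<close>

lemma order_continuous_norm_if_separable:
  assumes sep: "separable_space (bfs_top \<rho>)" and x: "x \<in> bfs \<rho>" and "0 < e"
  shows "\<exists>N. bfs_dist \<rho> x (trunc N x) < e"
proof (rule ccontr)
  assume "\<not> ?thesis"
  then have big: "e \<le> bfs_dist \<rho> x (trunc N x)" for N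
    by (meson not_less)
  define f where "f n = cmod (x n)" for n
  define tail where "tail N = (\<lambda>n. if n < N then 0 else f n)" for N
  have f: "f \<in> Mplus" and tail: "tail N \<in> Mplus" for N
    by (simp_all add: f_def Mplus_def tail_def)
  have rho_tail: "ennreal e \<le> \<rho> (tail N)" for N
  proof -
    have "(\<lambda>n. cmod (x n - trunc N x n)) = tail N"
      by (auto simp: tail_def f_def trunc_def)
    then show ?thesis
      using big[of N] rho_eq_bfs_norm[OF bfs_diff[OF x trunc_bfs[of N x]]]
      by (simp add: bfs_dist_def ennreal_leI)
  qed
  \<comment> \<open>By the Fatou axiom a tail of norm at least e carries half of it on a finite block.\<close>
  have "\<exists>M>N. ennreal (e/2) < \<rho> (trunc M (tail N))" for N
  proof (rule ccontr)
    assume "\<not> ?thesis"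
    then have "\<rho> (trunc M (tail N)) \<le> ennreal (e/2)" if "N < M" for M
      using that by (meson not_less)
    moreover have "\<rho> (trunc M (tail N)) \<le> \<rho> (trunc (max M (Suc N)) (tail N))" for M
      by (intro P2 trunc_Mplus tail) (auto simp: trunc_def tail_def f_def)
    ultimately have "\<rho> (trunc M (tail N)) \<le> ennreal (e/2)" for M
      by (rule order_trans[rotated]) simp
    then have "\<rho> (tail N) \<le> ennreal (e/2)"
      by (rule rho_le_if_trunc_le[OF tail])
    then have "ennreal e \<le> ennreal (e/2)"
      using rho_tail order_trans by blast
    then show False
      using \<open>0 < e\<close> by simp
  qed
  then obtain g where g: "N < g N" "ennreal (e/2) < \<rho> (trunc (g N) (tail N))" for N
    by metis
  \<comment> \<open>The k-th block is the interval from s k to s (k + 1).\<close>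
  define s where "s k = (g ^^ k) 0" for k
  have s_Suc: "s (Suc k) = g (s k)" for k
    by (simp add: s_def)
  have mono: "strict_mono s"
    by (rule strict_mono_Suc_iff[THEN iffD2]) (simp add: s_Suc g)
  define E where "E A = (\<Union>k\<in>A. {s k..<s (Suc k)})" for A
  define y where "y A n = (if n \<in> E A then x n else 0)" for A n
  have y: "y A \<in> bfs \<rho>" for A
    by (rule bfs_norm_mono[OF x]) (simp add: y_def)
  have notin_E: "n \<notin> E A" if "k \<notin> A" "s k \<le> n" "n < s (Suc k)" for A k n
  proof
    assume "n \<in> E A"
    then obtain j where j: "j \<in> A" "s j \<le> n" "n < s (Suc j)"
      by (auto simp: E_def)
    have "s j < s (Suc k)" "s k < s (Suc j)"
      using j that by linarith+
    then have "j = k"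
      using mono by (auto simp: strict_mono_less)
    then show False using j that by simp
  qed
  have sep1: "e/2 \<le> bfs_dist \<rho> (y A) (y B)" if k: "k \<in> A" "k \<notin> B" for A B k
  proof -
    have "ennreal (e/2) \<le> \<rho> (trunc (s (Suc k)) (tail (s k)))"
      using g(2)[of "s k"] by (simp add: s_Suc)
    also have "\<dots> \<le> \<rho> (\<lambda>n. cmod (y A n - y B n))"
    proof (intro P2 abs_Mplus allI)
      show "trunc (s (Suc k)) (tail (s k)) \<in> Mplus"
        by (intro trunc_Mplus tail)
      show "trunc (s (Suc k)) (tail (s k)) n \<le> cmod (y A n - y B n)" for n
        using k notin_E[of k B n] by (auto simp: trunc_def tail_def y_def E_def f_def)
    qed
    also have "\<dots> = ennreal (bfs_dist \<rho> (y A) (y B))"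
      unfolding bfs_dist_def by (intro rho_eq_bfs_norm bfs_diff y)
    finally show ?thesis
      by (simp add: bfs_dist_def)
  qed
  interpret Metric_space "bfs \<rho>" "bfs_dist \<rho>"
    by (rule Metric_space_bfs)
  have separated: "e/2 \<le> bfs_dist \<rho> (y A) (y B)" if "A \<noteq> B" for A B
    using that sep1[of _ A B] sep1[of _ B A] commute[of "y A" "y B"] by auto
  obtain D where D: "countable D" "D \<subseteq> bfs \<rho>" "mtopology closure_of D = bfs \<rho>"
    using sep unfolding separable_space_def by (auto simp: bfs_top_def)
  have "\<exists>d\<in>D. bfs_dist \<rho> (y A) d < e/4" for A
  proof -
    have "y A \<in> mtopology closure_of D"
      using D(3) y by simp
    then have "\<forall>r>0. \<exists>d\<in>D. d \<in> mball (y A) r"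
      unfolding metric_closure_of by blast
    moreover have "0 < e/4"
      using \<open>0 < e\<close> by simp
    ultimately show ?thesis
      unfolding in_mball by blast
  qed
  then obtain d where d: "d A \<in> D" "bfs_dist \<rho> (y A) (d A) < e/4" for A
    by metis
  have "inj d"
  proof
    fix A B assume "d A = d B"
    then have "bfs_dist \<rho> (y A) (y B) < e/2"
      using triangle[OF y[of A] _ y[of B], of "d A"] d[of A] d[of B] D(2) commute[of "d B" "y B"]
      by (auto simp: subset_iff)
    then show "A = B"
      using separated[of A B] by linarith
  qed
  moreover have "countable (range d)"
    using D(1) by (rule countable_subset[rotated]) (use d(1) in blast)
  ultimately have "countable (UNIV :: nat set set)"
    using countable_image_inj_on by blast
  then have "range (from_nat_into (UNIV :: nat set set)) = Pow UNIV"
    by (simp add: range_from_nat_into)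
  then show False
    using Cantors_theorem[of "UNIV :: nat set"] by blast
qed

end

section \<open>Rearrangement invariance and the norm of the shift\<close>

lemma equimeasurable_shift: "equimeasurable (shift x) x"
  unfolding equimeasurable_def
proof (intro allI impI)
  fix l :: real assume "0 \<le> l"
  have "n \<in> {n. cmod (shift x n) > l} \<longleftrightarrow> n \<in> Suc ` {n. cmod (x n) > l}" for n
    using \<open>0 \<le> l\<close> by (cases n) auto
  then have "{n. cmod (shift x n) > l} = Suc ` {n. cmod (x n) > l}"
    by blast
  then show "counting {n. cmod (shift x n) > l} = counting {n. cmod (x n) > l}"
    by (simp add: emeasure_count_space card_image finite_image_iff)
qed

lemma equimeasurable_unit:
  "equimeasurable (\<lambda>k. of_real (indicator {m} k)) (\<lambda>k. of_real (indicator {n} k))"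
proof -
  have "{k. l < cmod (of_real (indicator {m} k))} = (if l < 1 then {m} else {})"
    if "0 \<le> l" for l and m :: nat
    using that by (auto simp: indicator_def split: if_splits)
  then show ?thesis
    unfolding equimeasurable_def by simp
qed

text \<open>Rearrangement invariance enters only through two pairs of equimeasurable sequences: a sequence
  and its shift, and two unit vectors.\<close>

locale ri_function_norm = function_norm +
  assumes ri: "rearrangement_invariant \<rho>"
begin

lemma rho_eq_if_equimeasurable:
  assumes "x \<in> bfs \<rho>" "y \<in> bfs \<rho>" "equimeasurable x y"
  shows "\<rho> (\<lambda>n. cmod (x n)) = \<rho> (\<lambda>n. cmod (y n))"
  using ri assms unfolding rearrangement_invariant_def by (simp add: rho_eq_bfs_norm)

lemma rho_unit: "\<rho> (indicator {n}) = \<rho> (indicator {0})"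
proof -
  have cmod: "(\<lambda>k. cmod (of_real (indicator {m} k))) = indicator {m}" for m :: nat
    by (simp add: fun_eq_iff indicator_def)
  then have "(\<lambda>k. of_real (indicator {m} k)) \<in> bfs \<rho>" for m
    using rho_unit_finite by (simp add: bfs_iff)
  from rho_eq_if_equimeasurable[OF this this equimeasurable_unit] show ?thesis
    unfolding cmod .
qed

text \<open>Invariance compares norms only of sequences already known to belong to the space, so the
  shift of an arbitrary element is reached through its truncations, which always belong to it.\<close>

lemma rho_shift_le:
  assumes "f \<in> Mplus"
  shows "\<rho> (shift f) \<le> \<rho> f"
proof (rule rho_le_if_trunc_le)
  show "shift f \<in> Mplus"
    by (rule shift_Mplus) fact
  fix N
  define x where "x = trunc N (\<lambda>n. complex_of_real (f n))"
  have x: "x \<in> bfs \<rho>" "(\<lambda>n. cmod (x n)) = trunc N f"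
    using assms trunc_bfs by (auto simp: x_def trunc_def Mplus_def)
  have sx: "(\<lambda>n. cmod (shift x n)) = shift (trunc N f)"
    using assms by (auto simp: x_def trunc_def Mplus_def shift_def fun_eq_iff split: nat.split)
  have "shift x = trunc (Suc N) (shift x)"
    by (auto simp: x_def trunc_def shift_def fun_eq_iff split: nat.split)
  then have "shift x \<in> bfs \<rho>"
    by (metis trunc_bfs)
  have "\<rho> (trunc N (shift f)) \<le> \<rho> (shift (trunc N f))"
    using assms by (intro P2 shift_Mplus trunc_Mplus)
       (auto simp: trunc_def Mplus_def shift_def split: nat.split)
  also have "\<dots> = \<rho> (trunc N f)"
    using rho_eq_if_equimeasurable[OF \<open>shift x \<in> bfs \<rho>\<close> x(1) equimeasurable_shift]
    by (simp add: sx x(2))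
  also have "\<dots> \<le> \<rho> f"
    by (rule rho_trunc_mono) fact
  finally show "\<rho> (trunc N (shift f)) \<le> \<rho> f" .
qed

text \<open>The Neumann series bound for a shift of norm at most one. The recursion \<open>g = f + q S g\<close>
  turns the bound \<open>c\<close> for \<open>\<rho>\<close> of a truncation of \<open>g\<close> into \<open>\<rho> f + q c\<close> for the next
  truncation, and \<open>c = \<rho> f/(1-q)\<close> is the fixed point of this step. Working with truncations avoids
  any convergence of the series in the space.\<close>

lemma rho_geo_le:
  assumes f: "f \<in> Mplus" and q: "0 \<le> q" "q < 1"
  shows "\<rho> (geo q f) \<le> ennreal (1 / (1 - q)) * \<rho> f"
proof (rule rho_le_if_trunc_le)
  show g: "geo q f \<in> Mplus"
    by (intro geo_nonneg assms)
  show "\<rho> (trunc N (geo q f)) \<le> ennreal (1 / (1 - q)) * \<rho> f" for N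
  proof (induction N)
    case 0
    then show ?case using rho_zero by (simp add: trunc_def[abs_def])
  next
    case (Suc N)
    let ?s = "shift (trunc N (geo q f))"
    have s: "?s \<in> Mplus"
      by (intro shift_Mplus trunc_Mplus g)
    have "trunc (Suc N) (geo q f) n \<le> f n + q * ?s n" for n
      using f by (cases n) (auto simp: trunc_def Mplus_def)
    then have "\<rho> (trunc (Suc N) (geo q f)) \<le> \<rho> (\<lambda>n. f n + q * ?s n)"
      using f s q trunc_Mplus[OF g] by (intro P2) (auto simp: Mplus_def)
    also have "\<dots> \<le> \<rho> f + \<rho> (\<lambda>n. q * ?s n)"
      using f s q by (intro P1_triangle) (auto simp: Mplus_def)
    also have "\<rho> (\<lambda>n. q * ?s n) = ennreal q * \<rho> ?s"
      by (intro P1_scale s q)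
    also have "\<dots> \<le> ennreal q * (ennreal (1 / (1 - q)) * \<rho> f)"
      by (intro mult_left_mono order_trans[OF rho_shift_le[OF trunc_Mplus[OF g]] Suc]) simp
    also have "\<rho> f + \<dots> = (1 + ennreal q * ennreal (1 / (1 - q))) * \<rho> f"
      by (simp add: distrib_right mult.assoc)
    also have "1 + ennreal q * ennreal (1 / (1 - q)) = ennreal (1 + q * (1 / (1 - q)))"
      using q by (subst ennreal_plus) (simp_all flip: ennreal_mult)
    also have "1 + q * (1 / (1 - q)) = 1 / (1 - q)"
      using q by (simp add: field_simps)
    finally show ?case by (simp add: add_left_mono)
  qed
qed

lemma bfs_norm_le_geo:
  assumes x: "x \<in> bfs \<rho>" and q: "0 \<le> q" "q < 1" and "0 \<le> K"
    and le: "\<And>n. cmod (y n) \<le> K * geo q (\<lambda>k. cmod (x k)) n"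
  shows "y \<in> bfs \<rho>" "bfs_norm \<rho> y \<le> K / (1 - q) * bfs_norm \<rho> x"
proof -
  let ?g = "geo q (\<lambda>k. cmod (x k))"
  have g: "?g \<in> Mplus"
    by (intro geo_nonneg q abs_Mplus)
  have "\<rho> (\<lambda>n. cmod (y n)) \<le> \<rho> (\<lambda>n. K * ?g n)"
    using le g \<open>0 \<le> K\<close> by (intro P2 abs_Mplus) (auto simp: Mplus_def)
  also have "\<dots> = ennreal K * \<rho> ?g"
    by (intro P1_scale g \<open>0 \<le> K\<close>)
  also have "\<dots> \<le> ennreal K * (ennreal (1 / (1 - q)) * \<rho> (\<lambda>k. cmod (x k)))"
    by (intro mult_left_mono rho_geo_le abs_Mplus q) simp
  also have "\<dots> = ennreal (K / (1 - q) * bfs_norm \<rho> x)"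
    using q \<open>0 \<le> K\<close> by (simp add: rho_eq_bfs_norm[OF x] ennreal_mult[symmetric] mult.assoc)
  finally have "\<rho> (\<lambda>n. cmod (y n)) \<le> ennreal (K / (1 - q) * bfs_norm \<rho> x)" .
  moreover have "0 \<le> K / (1 - q) * bfs_norm \<rho> x"
    using q \<open>0 \<le> K\<close> by simp
  ultimately show "y \<in> bfs \<rho>" "bfs_norm \<rho> y \<le> K / (1 - q) * bfs_norm \<rho> x"
    by (rule bfs_normI)+
qed

lemma geo_bfs:
  assumes "x \<in> bfs \<rho>" "0 \<le> t" "t < 1"
  shows "geo (of_real t) x \<in> bfs \<rho>"
proof (rule bfs_norm_le_geo(1)[OF assms zero_le_one])
  show "cmod (geo (of_real t) x n) \<le> 1 * geo t (\<lambda>k. cmod (x k)) n" for n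
    using norm_geo_le[of "of_real t" x n] \<open>0 \<le> t\<close> by simp
qed

lemma shift_bfs:
  assumes "x \<in> bfs \<rho>"
  shows "shift x \<in> bfs \<rho>"
proof -
  have "(\<lambda>n. cmod (shift x n)) = shift (\<lambda>n. cmod (x n))"
    by (simp add: shift_def fun_eq_iff split: nat.split)
  then show ?thesis
    using assms le_less_trans[OF rho_shift_le[OF abs_Mplus, of x]] by (simp add: bfs_iff)
qed

section \<open>Boundedness and compactness\<close>

text \<open>Beyond the first \<open>N\<close> coordinates the diagonal factor is at most \<open>1/(N+1)\<close>. For \<open>N = 0\<close> this is
  the bound for the whole operator; as \<open>N\<close> grows it says that the operator is a norm limit of its
  truncations, which have finite rank.\<close>

lemma cesaro_tail:
  assumes "x \<in> bfs \<rho>" "0 \<le> t" "t < 1"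
  shows "cesaro t x \<in> bfs \<rho>"
    and "bfs_dist \<rho> (cesaro t x) (trunc N (cesaro t x)) \<le> 1 / (real N + 1) / (1 - t) * bfs_norm \<rho> x"
proof -
  have le: "cmod (cesaro t x n - trunc N (cesaro t x) n) \<le> 1 / (real N + 1) * geo t (\<lambda>k. cmod (x k)) n"
    for N n
  proof (cases "n < N")
    case True
    then show ?thesis
      using geo_nonneg[OF \<open>0 \<le> t\<close> abs_Mplus, of x] by (simp add: trunc_def Mplus_def)
  next
    case False
    have "cmod (geo (of_real t) x n) \<le> geo t (\<lambda>k. cmod (x k)) n"
      using norm_geo_le[of "of_real t" x n] \<open>0 \<le> t\<close> by simp
    moreover have "cmod (cesaro t x n) = cmod (geo (of_real t) x n) / (real n + 1)"
      unfolding cesaro_eq_geo norm_divide norm_of_nat by simp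
    moreover have "0 \<le> geo t (\<lambda>k. cmod (x k)) n"
      using geo_nonneg[OF \<open>0 \<le> t\<close> abs_Mplus, of x] by (simp add: Mplus_def)
    ultimately show ?thesis
      using False by (simp add: trunc_def frac_le)
  qed
  have "(\<lambda>n. cesaro t x n - trunc 0 (cesaro t x) n) = cesaro t x"
    by (simp add: trunc_def)
  then show "cesaro t x \<in> bfs \<rho>"
    using bfs_norm_le_geo(1)[OF assms _ le[of _ 0]] by simp
  show "bfs_dist \<rho> (cesaro t x) (trunc N (cesaro t x)) \<le> 1 / (real N + 1) / (1 - t) * bfs_norm \<rho> x"
    unfolding bfs_dist_def by (rule bfs_norm_le_geo(2)[OF assms _ le]) simp
qed

lemma cesaro_bound:
  assumes "x \<in> bfs \<rho>" "0 \<le> t" "t < 1"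
  shows "bfs_norm \<rho> (cesaro t x) \<le> 1 / (1 - t) * bfs_norm \<rho> x"
  using cesaro_tail(2)[OF assms, of 0] by (simp add: bfs_dist_def trunc_def)

lemma cesaro_bounded_op:
  assumes "0 \<le> t" "t < 1"
  shows "cesaro t \<in> bounded_ops \<rho>"
proof (rule bounded_opsI)
  show "cesaro t x \<in> bfs \<rho> \<and> bfs_norm \<rho> (cesaro t x) \<le> 1 / (1 - t) * bfs_norm \<rho> x"
    if "x \<in> bfs \<rho>" for x
    using cesaro_tail(1) cesaro_bound that assms by blast
qed (use assms in \<open>simp_all add: cesaro_add cesaro_scale\<close>)

lemma cesaro_op_norm_le:
  assumes "0 \<le> t" "t < 1"
  shows "op_norm \<rho> (cesaro t) \<le> ennreal (1 / (1 - t))"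
  unfolding op_norm_def
proof (rule SUP_least)
  fix x assume "x \<in> {x \<in> bfs \<rho>. bfs_norm \<rho> x \<le> 1}"
  then have x: "x \<in> bfs \<rho>" "bfs_norm \<rho> x \<le> 1"
    by auto
  have "bfs_norm \<rho> (cesaro t x) \<le> 1 / (1 - t) * bfs_norm \<rho> x"
    by (intro cesaro_bound x assms)
  also have "\<dots> \<le> 1 / (1 - t) * 1"
    using x assms by (intro mult_left_mono) auto
  finally show "\<rho> (\<lambda>n. cmod (cesaro t x n)) \<le> ennreal (1 / (1 - t))"
    using cesaro_tail(1)[OF x(1) assms] by (simp add: rho_eq_bfs_norm ennreal_leI)
qed

text \<open>A bounded sequence that tends to \<open>0\<close> coordinatewise is mapped to one that tends to \<open>0\<close> in norm:
  the tails of the images are uniformly small and finitely many coordinates remain.\<close>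

lemma cesaro_tendsto_0:
  assumes t: "0 \<le> t" "t < 1"
    and Z: "\<And>k. Z k \<in> bfs \<rho>" "\<And>k. bfs_norm \<rho> (Z k) \<le> B" "\<And>n. (\<lambda>k. Z k n) \<longlonglongrightarrow> 0"
    and "0 < e"
  shows "eventually (\<lambda>k. bfs_norm \<rho> (cesaro t (Z k)) < e) sequentially"
proof -
  have "0 \<le> B"
    using Z(2)[of 0] bfs_norm_nonneg[of "Z 0"] by linarith
  have geo: "(\<lambda>k. geo (of_real t) (Z k) n) \<longlonglongrightarrow> 0" for n
  proof (induction n)
    case (Suc n)
    show ?case
      using tendsto_add[OF Z(3)[of "Suc n"] tendsto_mult_right_zero[OF Suc]] by simp
  qed (simp add: Z(3))
  have "(\<lambda>k. cmod (cesaro t (Z k) n)) \<longlonglongrightarrow> 0" for n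
    unfolding cesaro_eq_geo by (intro tendsto_norm_zero tendsto_divide_zero geo)
  then have lim: "(\<lambda>k. \<rho> (trunc N (\<lambda>n. cmod (cesaro t (Z k) n)))) \<longlonglongrightarrow> 0" for N
    by (intro rho_trunc_tendsto_0 abs_Mplus)
  obtain N where "2 * B / (1 - t) / e < real N"
    using reals_Archimedean2 by blast
  then have N: "1 / (real N + 1) / (1 - t) * B < e / 2"
  proof -
    have "2 * (B / (1 - t)) < e * (real N + 1)"
      using \<open>2 * B / (1 - t) / e < real N\<close> \<open>0 < e\<close>
      unfolding pos_divide_less_eq[OF \<open>0 < e\<close>] by (simp add: algebra_simps)
    then have "B / (1 - t) / (real N + 1) < e / 2"
      by (subst pos_divide_less_eq) linarith+
    then show ?thesis
      by (simp add: mult.commute)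
  qed
  have "eventually (\<lambda>k. \<rho> (trunc N (\<lambda>n. cmod (cesaro t (Z k) n))) < ennreal (e / 2)) sequentially"
    using \<open>0 < e\<close> by (intro order_tendstoD[OF lim]) simp
  then show ?thesis
  proof eventually_elim
    case (elim k)
    let ?y = "cesaro t (Z k)"
    have y: "?y \<in> bfs \<rho>"
      by (intro cesaro_tail Z t)
    have "(\<lambda>n. cmod (trunc N ?y n)) = trunc N (\<lambda>n. cmod (?y n))"
      by (simp add: trunc_def fun_eq_iff)
    then have "bfs_norm \<rho> (trunc N ?y) < e / 2"
      using elim rho_eq_bfs_norm[OF trunc_bfs, of N ?y] by (simp add: ennreal_less_iff)
    moreover have "bfs_dist \<rho> ?y (trunc N ?y) < e / 2"
    proof -
      have "bfs_dist \<rho> ?y (trunc N ?y) \<le> 1 / (real N + 1) / (1 - t) * bfs_norm \<rho> (Z k)"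
        by (intro cesaro_tail Z t)
      also have "\<dots> \<le> 1 / (real N + 1) / (1 - t) * B"
        using t by (intro mult_left_mono Z) auto
      also have "\<dots> < e / 2"
        by (rule N)
      finally show ?thesis .
    qed
    moreover have "bfs_norm \<rho> ?y \<le> bfs_norm \<rho> (trunc N ?y) + bfs_dist \<rho> ?y (trunc N ?y)"
      using bfs_norm_add[OF trunc_bfs bfs_diff[OF y trunc_bfs], of N ?y N ?y]
      by (simp add: bfs_dist_def)
    ultimately show ?case by linarith
  qed
qed

text \<open>Coordinatewise compactness of the unit ball becomes norm compactness of its image, so the image
  is already closed.\<close>

lemma cesaro_compact:
  assumes t: "0 \<le> t" "t < 1"
  shows "compact_op \<rho> (cesaro t)"
proof -
  interpret Metric_space "bfs \<rho>" "bfs_dist \<rho>"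
    by (rule Metric_space_bfs)
  let ?B = "{x \<in> bfs \<rho>. bfs_norm \<rho> x \<le> 1}"
  have "compactin mtopology (cesaro t ` ?B)"
    unfolding compactin_sequentially
  proof (intro conjI allI impI)
    show "cesaro t ` ?B \<subseteq> bfs \<rho>"
      using cesaro_tail(1) t by auto
    fix \<sigma> :: "nat \<Rightarrow> nat \<Rightarrow> complex"
    assume "range \<sigma> \<subseteq> cesaro t ` ?B"
    then have "\<forall>k. \<exists>x. x \<in> ?B \<and> \<sigma> k = cesaro t x"
      by blast
    from choice[OF this] obtain X where "\<forall>k. X k \<in> ?B \<and> \<sigma> k = cesaro t (X k)"
      by blast
    then have X: "X k \<in> bfs \<rho>" "bfs_norm \<rho> (X k) \<le> 1" "\<sigma> k = cesaro t (X k)" for k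
      by auto
    obtain r x where r: "strict_mono r" and x: "x \<in> bfs \<rho>" "bfs_norm \<rho> x \<le> 1"
      and lim: "\<forall>n. (\<lambda>k. X (r k) n) \<longlonglongrightarrow> x n"
      using unit_ball_coordinatewise_compact[of X, OF X(1,2)] by blast
    define Z where "Z k n = X (r k) n - x n" for k n
    have Z: "Z k \<in> bfs \<rho>" for k
      unfolding Z_def by (intro bfs_diff X x)
    have Z_le: "bfs_norm \<rho> (Z k) \<le> 2" for k
    proof -
      have "bfs_norm \<rho> (\<lambda>n. - x n) = bfs_norm \<rho> x"
        by (simp add: bfs_norm_def)
      then show ?thesis
        using bfs_norm_add[OF X(1) bfs_scale[OF x(1), of "-1"], of "r k"] X(2)[of "r k"] x(2)
        by (simp add: Z_def[abs_def])
    qed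
    have Z_lim: "(\<lambda>k. Z k n) \<longlonglongrightarrow> 0" for n
      unfolding Z_def by (intro LIM_zero lim[rule_format])
    have "bfs_dist \<rho> (cesaro t (X (r k))) (cesaro t x) = bfs_norm \<rho> (cesaro t (Z k))" for k
      by (simp add: bfs_dist_def Z_def[abs_def] cesaro_diff)
    then have "limitin mtopology (\<sigma> \<circ> r) (cesaro t x) sequentially"
      unfolding limitin_metric using cesaro_tendsto_0[OF t Z Z_le Z_lim]
      by (simp add: X x cesaro_tail(1)[OF _ t])
    then show "\<exists>l r. l \<in> cesaro t ` ?B \<and> strict_mono r \<and> limitin mtopology (\<sigma> \<circ> r) l sequentially"
      using x r by blast
  qed
  moreover from this have "mtopology closure_of (cesaro t ` ?B) = cesaro t ` ?B"
    by (simp add: closure_of_closedin compactin_imp_closedin Hausdorff_space_mtopology)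
  ultimately show ?thesis
    using cesaro_bounded_op[OF t] by (simp add: compact_op_def bfs_top_def)
qed

end

section \<open>The inverse of the shifted operator\<close>

lemma shifted_0 [simp]: "shifted T 0 = T"
  by (simp add: shifted_def fun_eq_iff)

text \<open>With \<open>y = geo t z\<close>, the equation \<open>cesaro t z n - l * z n = x n\<close> for all \<open>n\<close> reads
  \<open>(1/(n+1) - l) * y n + l * t * y (n-1) = x n\<close>, a lower bidiagonal system. It is solved for \<open>y\<close> by
  forward substitution whenever no diagonal entry vanishes, that is, when \<open>l \<notin> Lambda\<close>; this includes
  \<open>l = 0\<close>. The solution of the original equation is then \<open>z = ungeo t y\<close>.\<close>

primrec forward_subst :: "real \<Rightarrow> complex \<Rightarrow> (nat \<Rightarrow> complex) \<Rightarrow> nat \<Rightarrow> complex" where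
  "forward_subst t l x 0 = x 0 / (1 - l)"
| "forward_subst t l x (Suc n) =
     (x (Suc n) - l * of_real t * forward_subst t l x n) / (1 / of_nat (n + 2) - l)"

definition resolvent :: "real \<Rightarrow> complex \<Rightarrow> (nat \<Rightarrow> complex) \<Rightarrow> nat \<Rightarrow> complex" where
  "resolvent t l x = ungeo (of_real t) (forward_subst t l x)"

lemma zero_notin_Lambda: "0 \<notin> Lambda"
proof
  assume "0 \<in> Lambda"
  then obtain n where "1 / of_nat (n + 1) = (0 :: complex)"
    by (auto simp: Lambda_def)
  then have "of_nat (n + 1) = (0 :: complex)"
    by simp
  then show False
    unfolding of_nat_eq_0_iff by simp
qed

lemma not_Lambda: "l \<notin> Lambda \<Longrightarrow> 1 / of_nat (n + 1) - l \<noteq> 0"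
  by (auto simp: Lambda_def)

text \<open>Off \<open>Lambda\<close>, \<open>resolvent t l\<close> is a two-sided inverse on all sequences. Whether it
  preserves the space is a separate question, which depends on \<open>l\<close> being nonzero.\<close>

lemma shifted_resolvent:
  assumes "l \<notin> Lambda"
  shows "shifted (cesaro t) l (resolvent t l x) = x"
proof
  fix n
  have "1 - l \<noteq> 0"
    using not_Lambda[OF assms, of 0] by simp
  show "shifted (cesaro t) l (resolvent t l x) n = x n"
  proof (cases n)
    case 0
    have "x 0 / (1 - l) - l * (x 0 / (1 - l)) = (1 - l) * (x 0 / (1 - l))"
      by (simp only: left_diff_distrib mult_1)
    also have "\<dots> = x 0"
      using \<open>1 - l \<noteq> 0\<close> by simp
    finally show ?thesis
      unfolding 0 shifted_def cesaro_eq_geo resolvent_def geo_ungeo by (simp add: ungeo_def)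
  next
    case (Suc m)
    let ?y = "forward_subst t l x"
    have solve: "?y (Suc m) * (1 / of_nat (m + 2) - l) = x (Suc m) - l * of_real t * ?y m"
      using not_Lambda[OF assms, of "Suc m"] by simp
    have *: "y / d - l * (y - r * z) = y * (1 / d - l) + l * r * z" for y d r z :: complex
      by (simp add: algebra_simps)
    have "shifted (cesaro t) l (resolvent t l x) n
        = ?y (Suc m) / of_nat (m + 2) - l * (?y (Suc m) - of_real t * ?y m)"
      unfolding Suc shifted_def cesaro_eq_geo resolvent_def geo_ungeo by (simp add: ungeo_def)
    then show ?thesis
      unfolding * solve Suc by simp
  qed
qed

lemma forward_subst_shifted:
  assumes "l \<notin> Lambda"
  shows "forward_subst t l (shifted (cesaro t) l x) n = geo (of_real t) x n"
proof (induction n)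
  case 0
  show ?case
    using not_Lambda[OF assms, of 0]
    by (simp add: shifted_def cesaro_eq_geo divide_eq_eq) (simp add: algebra_simps)
next
  case (Suc n)
  have "shifted (cesaro t) l x (Suc n) - l * of_real t * geo (of_real t) x n
      = geo (of_real t) x (Suc n) * (1 / of_nat (n + 2) - l)"
    by (simp add: shifted_def cesaro_eq_geo algebra_simps add_divide_distrib)
  then show ?case
    unfolding forward_subst.simps Suc
    using not_Lambda[OF assms, of "Suc n"] by simp
qed

lemma resolvent_shifted:
  assumes "l \<notin> Lambda"
  shows "resolvent t l (shifted (cesaro t) l x) = x"
proof -
  have "forward_subst t l (shifted (cesaro t) l x) = geo (of_real t) x"
    using forward_subst_shifted[OF assms] by blast
  then show ?thesis by (simp add: resolvent_def)
qed

lemma resolvent_eqI: "l \<notin> Lambda \<Longrightarrow> shifted (cesaro t) l y = x \<Longrightarrow> resolvent t l x = y"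
  using resolvent_shifted by blast

lemma resolvent_add:
  assumes "l \<notin> Lambda"
  shows "resolvent t l (\<lambda>n. x n + y n) = (\<lambda>n. resolvent t l x n + resolvent t l y n)"
proof (rule resolvent_eqI[OF assms])
  have "shifted (cesaro t) l (\<lambda>n. u n + v n) =
      (\<lambda>n. shifted (cesaro t) l u n + shifted (cesaro t) l v n)" for u v
    by (simp add: shifted_def cesaro_add algebra_simps)
  then show "shifted (cesaro t) l (\<lambda>n. resolvent t l x n + resolvent t l y n) = (\<lambda>n. x n + y n)"
    by (simp add: shifted_resolvent[OF assms])
qed

lemma resolvent_scale:
  assumes "l \<notin> Lambda"
  shows "resolvent t l (\<lambda>n. a * x n) = (\<lambda>n. a * resolvent t l x n)"
proof (rule resolvent_eqI[OF assms])
  have "shifted (cesaro t) l (\<lambda>n. a * u n) = (\<lambda>n. a * shifted (cesaro t) l u n)" for u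
    by (simp add: shifted_def cesaro_scale algebra_simps)
  then show "shifted (cesaro t) l (\<lambda>n. a * resolvent t l x n) = (\<lambda>n. a * x n)"
    by (simp add: shifted_resolvent[OF assms])
qed

text \<open>The coefficient of \<open>y (n-1)\<close> in the recursion has modulus tending to \<open>t < q\<close>, because the diagonal
  entries tend to \<open>-l \<noteq> 0\<close>. So the solution is dominated by a multiple of the geometric convolution
  with ratio \<open>q\<close>; the finitely many coefficients larger than \<open>q\<close> cost only a constant factor.\<close>

lemma norm_forward_subst_le:
  assumes l: "l \<notin> Lambda" "l \<noteq> 0" and t: "0 \<le> t" "t < q"
  shows "\<exists>K\<ge>0. \<forall>x n. cmod (forward_subst t l x n) \<le> K * geo q (\<lambda>k. cmod (x k)) n"
proof -
  define a where "a n = 1 / (1 / of_nat (n + 1) - l)" for n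
  have "(\<lambda>n. 1 / complex_of_nat (Suc n)) \<longlonglongrightarrow> 0"
    by (rule LIMSEQ_Suc[OF lim_1_over_n])
  then have a_lim: "a \<longlonglongrightarrow> 1 / (0 - l)"
    unfolding a_def using l by (intro tendsto_intros) auto
  then have "Bseq a"
    by (intro convergent_imp_Bseq convergentI)
  then obtain A where A: "0 < A" "\<And>n. cmod (a n) \<le> A"
    by (auto simp: Bseq_def)
  have "0 < q" using t by simp
  have "(\<lambda>n. cmod (l * of_real t * a n)) \<longlonglongrightarrow> cmod (l * of_real t * (1 / (0 - l)))"
    by (intro tendsto_intros a_lim)
  also have "cmod (l * of_real t * (1 / (0 - l))) = t"
    using l t by (simp add: norm_mult norm_divide)
  finally have "eventually (\<lambda>n. cmod (l * of_real t * a n) < q) sequentially"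
    by (rule order_tendstoD) (rule t)
  then obtain N where N: "\<And>n. N \<le> n \<Longrightarrow> cmod (l * of_real t * a n) \<le> q"
    by (auto simp: eventually_sequentially intro: less_imp_le)
  \<comment> \<open>c n grows by the factor L at each of the first N indices and is constant afterwards.\<close>
  define L where "L = max 1 (cmod l * t * A / q)"
  define c where "c n = A * L ^ min n N" for n
  have L: "1 \<le> L" "cmod l * t * A \<le> q * L"
    using \<open>0 < q\<close> by (auto simp: L_def max_def field_simps)
  have A_le_c: "A \<le> c n" for n
    using A L by (simp add: c_def)
  have step: "cmod (l * of_real t * a (Suc n)) * c n \<le> q * c (Suc n)" for n
  proof (cases "Suc n \<le> N")
    case True
    have "cmod (l * of_real t * a (Suc n)) \<le> cmod l * t * A"
      using t A by (simp add: norm_mult mult_left_mono)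
    also have "\<dots> \<le> q * L"
      by (rule L)
    finally have "cmod (l * of_real t * a (Suc n)) * c n \<le> q * L * c n"
      using A_le_c[of n] A by (intro mult_right_mono) auto
    also have "q * L * c n = q * c (Suc n)"
      using True by (simp add: c_def min_def)
    finally show ?thesis .
  next
    case False
    then have "min (Suc n) N = N" "min n N = N"
      by auto
    then have "c (Suc n) = c n"
      by (simp add: c_def)
    then show ?thesis
      using N[of "Suc n"] False A_le_c[of n] A by (auto intro!: mult_right_mono)
  qed
  have le: "cmod (forward_subst t l x n) \<le> c n * geo q (\<lambda>k. cmod (x k)) n" for x n
  proof (induction n)
    case 0
    have "cmod (forward_subst t l x 0) = cmod (a 0) * cmod (x 0)"
      by (simp add: a_def norm_divide)
    also have "\<dots> \<le> c 0 * cmod (x 0)"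
      using A(2)[of 0] A_le_c[of 0] by (intro mult_right_mono) auto
    finally show ?case by simp
  next
    case (Suc n)
    have "forward_subst t l x (Suc n) =
        a (Suc n) * x (Suc n) - l * of_real t * a (Suc n) * forward_subst t l x n"
      by (simp add: a_def diff_divide_distrib mult_ac)
    then have "cmod (forward_subst t l x (Suc n)) \<le>
        cmod (a (Suc n)) * cmod (x (Suc n)) + cmod (l * of_real t * a (Suc n)) * cmod (forward_subst t l x n)"
      by (metis norm_mult norm_triangle_ineq4)
    also have "cmod (a (Suc n)) * cmod (x (Suc n)) \<le> c (Suc n) * cmod (x (Suc n))"
      using A(2)[of "Suc n"] A_le_c[of "Suc n"] by (intro mult_right_mono) auto
    also have "cmod (l * of_real t * a (Suc n)) * cmod (forward_subst t l x n) \<le>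
        cmod (l * of_real t * a (Suc n)) * (c n * geo q (\<lambda>k. cmod (x k)) n)"
      by (intro mult_left_mono Suc norm_ge_zero)
    also have "\<dots> = cmod (l * of_real t * a (Suc n)) * c n * geo q (\<lambda>k. cmod (x k)) n"
      by simp
    also have "\<dots> \<le> q * c (Suc n) * geo q (\<lambda>k. cmod (x k)) n"
      using geo_nonneg[of q "\<lambda>k. cmod (x k)"] \<open>0 < q\<close>
      by (intro mult_right_mono step) (auto simp: Mplus_def)
    finally show ?case by (simp add: algebra_simps)
  qed
  have "c n \<le> A * L ^ N" for n
    using A L by (simp add: c_def power_increasing)
  moreover have "0 \<le> geo q (\<lambda>k. cmod (x k)) n" for x :: "nat \<Rightarrow> complex" and n
    using geo_nonneg[of q "\<lambda>k. cmod (x k)"] \<open>0 < q\<close> by (auto simp: Mplus_def)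
  ultimately have "cmod (forward_subst t l x n) \<le> A * L ^ N * geo q (\<lambda>k. cmod (x k)) n" for x n
    by (intro order_trans[OF le] mult_right_mono)
  moreover have "0 \<le> A * L ^ N"
    using A L by simp
  ultimately show ?thesis
    by blast
qed

section \<open>Point spectrum, range and spectra\<close>

text \<open>For \<open>n < m\<close> the truncated exponent \<open>n - m\<close> is harmless, since the binomial coefficient vanishes.\<close>

definition eigenvector :: "real \<Rightarrow> nat \<Rightarrow> nat \<Rightarrow> complex" where
  "eigenvector t m n = of_nat (n choose m) * of_real t ^ (n - m)"

text \<open>Pascal's rule; equivalently, the generating function of \<open>eigenvector t m\<close> is
  \<open>z ^ m / (1 - t z) ^ (m + 1)\<close>, so that convolution with \<open>t\<^sup>n\<close> and one shift lead from \<open>m\<close> to \<open>m + 1\<close>.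
  Together with the absorption identity for binomials this gives the eigenvalue equation, and it also
  shows that the eigenvectors are obtained from a unit vector by operators that preserve the space.\<close>

lemma geo_eigenvector:
  "geo (of_real t) (eigenvector t m) n = eigenvector t (Suc m) (Suc n)"
proof (induction n)
  case 0
  show ?case by (cases m) (simp_all add: eigenvector_def)
next
  case (Suc n)
  have "geo (of_real t) (eigenvector t m) (Suc n)
      = eigenvector t m (Suc n) + of_real t * eigenvector t (Suc m) (Suc n)"
    by (simp add: Suc)
  also have "\<dots> = eigenvector t (Suc m) (Suc (Suc n))"
  proof (cases "m \<le> n")
    case True
    then show ?thesis
      by (simp add: eigenvector_def Suc_diff_le algebra_simps)
  qed (auto simp: eigenvector_def not_le binomial_eq_0)
  finally show ?case .
qed

lemma cesaro_eigenvector: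
  "cesaro t (eigenvector t m) = (\<lambda>n. 1 / of_nat (m + 1) * eigenvector t m n)"
proof
  fix n
  have "of_nat (Suc n) * of_nat (n choose m) = (of_nat (Suc n choose Suc m) * of_nat (Suc m) :: complex)"
    unfolding of_nat_mult[symmetric] Suc_times_binomial_eq ..
  then have "of_nat (Suc n choose Suc m) / of_nat (n + 1) = (1 / of_nat (m + 1) * of_nat (n choose m) :: complex)"
    by (simp add: field_simps del: binomial_Suc_Suc of_nat_Suc)
  moreover have "cesaro t (eigenvector t m) n
      = of_nat (Suc n choose Suc m) / of_nat (n + 1) * of_real t ^ (n - m)"
    unfolding cesaro_eq_geo geo_eigenvector eigenvector_def by simp
  ultimately show "cesaro t (eigenvector t m) n = 1 / of_nat (m + 1) * eigenvector t m n"
    by (simp add: eigenvector_def)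
qed

lemma shifted_eigenvector: "shifted (cesaro t) (1 / of_nat (m + 1)) (eigenvector t m) = (\<lambda>_. 0)"
  by (simp add: shifted_def cesaro_eigenvector)

context ri_function_norm
begin

lemma resolvent_bounded_op:
  assumes l: "l \<notin> Lambda" "l \<noteq> 0" and t: "0 \<le> t" "t < 1"
  shows "resolvent t l \<in> bounded_ops \<rho>"
proof -
  define q where "q = (1 + t) / 2"
  have q: "0 \<le> q" "t < q" "q < 1"
    using t by (auto simp: q_def)
  obtain K where K: "0 \<le> K"
    "\<forall>x n. cmod (forward_subst t l x n) \<le> K * geo q (\<lambda>k. cmod (x k)) n"
    using norm_forward_subst_le[OF l t(1) q(2)] by blast
  have bound: "resolvent t l x \<in> bfs \<rho> \<and> bfs_norm \<rho> (resolvent t l x) \<le> (2 * (K / (1 - q))) * bfs_norm \<rho> x"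
    if x: "x \<in> bfs \<rho>" for x
  proof -
    let ?y = "forward_subst t l x"
    let ?g = "geo q (\<lambda>k. cmod (x k))"
    have g: "0 \<le> ?g n" for n
      using geo_nonneg[OF q(1) abs_Mplus, of x] by (simp add: Mplus_def)
    \<comment> \<open>The recursion for ?g has only nonnegative terms, so dropping the input leaves q times its shift.\<close>
    have g_Suc: "q * shift ?g n \<le> ?g n" for n
      using g[of n] by (cases n) simp_all
    have "cmod (resolvent t l x n) \<le> 2 * K * ?g n" for n
    proof -
      have "cmod (resolvent t l x n) \<le> cmod (?y n) + t * cmod (shift ?y n)"
        unfolding resolvent_def ungeo_def
        using norm_triangle_ineq4[of "?y n" "of_real t * shift ?y n"] t by (simp add: norm_mult)
      also have "t * cmod (shift ?y n) \<le> q * (K * shift ?g n)"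
        using K q t by (intro mult_mono) (auto simp: shift_def split: nat.split)
      also have "\<dots> \<le> K * ?g n"
        using mult_left_mono[OF g_Suc K(1), of n] by (simp add: mult_ac)
      finally show ?thesis using K(2)[rule_format, of x n] by simp
    qed
    from bfs_norm_le_geo[OF x q(1,3) _ this] K(1) show ?thesis by simp
  qed
  show ?thesis
    using K q by (intro bounded_opsI[OF resolvent_add[OF l(1)] resolvent_scale[OF l(1)] bound]) auto
qed

lemma eigenvector_bfs:
  assumes t: "0 \<le> t" "t < 1"
  shows "eigenvector t m \<in> bfs \<rho>"
proof (induction m)
  case 0
  have "eigenvector t 0 n = geo (of_real t) (trunc 1 (\<lambda>_. 1)) n" for n
    by (induction n) (simp_all add: eigenvector_def trunc_def)
  then show ?case
    using geo_bfs[OF trunc_bfs t] by presburger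
next
  case (Suc m)
  have "eigenvector t (Suc m) = shift (geo (of_real t) (eigenvector t m))"
  proof
    show "eigenvector t (Suc m) n = shift (geo (of_real t) (eigenvector t m)) n" for n
      by (cases n) (simp_all add: geo_eigenvector, simp add: eigenvector_def)
  qed
  then show ?case
    using shift_bfs[OF geo_bfs[OF Suc t]] by simp
qed

text \<open>All unit vectors have the same norm, so a geometrically weighted sum of them belongs to the
  space wherever its support lies. Placing the weight \<open>1/2\<^sup>j\<close> at the index \<open>4\<^sup>j\<close> makes the product
  of index and coordinate unbounded.\<close>

lemma ex_sparse_geometric:
  "\<exists>w\<in>bfs \<rho>. \<forall>j. (1/2) ^ j \<le> cmod (w (4 ^ j))"
proof -
  obtain u where u: "\<rho> (indicator {0}) = ennreal u" "0 < u"
    using rho_unit_real by blast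
  define s :: "nat \<Rightarrow> nat \<Rightarrow> real" where "s n j = (1/2) ^ j * indicator {4 ^ j} n" for n j :: nat
  have s_nonneg: "0 \<le> s n j" for n j
    by (simp add: s_def)
  have summable: "summable (s n)" for n
  proof (rule summable_comparison_test'[OF summable_geometric[of "1/2::real"]])
    show "norm (s n j) \<le> (1/2) ^ j" for j
      by (simp add: s_def indicator_def)
  qed simp
  define f where "f n = suminf (s n)" for n
  define F where "F k n = (\<Sum>j<k. s n j)" for k n
  have F: "F k \<in> Mplus" for k
    by (simp add: F_def Mplus_def s_nonneg sum_nonneg)
  have F_le: "\<rho> (F k) \<le> ennreal ((\<Sum>j<k. (1/2) ^ j) * u)" for k
  proof (induction k)
    case 0
    then show ?case using rho_zero by (simp add: F_def[abs_def])
  next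
    case (Suc k)
    have "F (Suc k) = (\<lambda>n. F k n + (1/2) ^ k * indicator {4 ^ k} n)"
      unfolding F_def sum.lessThan_Suc by (simp only: s_def)
    then have "\<rho> (F (Suc k)) \<le> \<rho> (F k) + \<rho> (\<lambda>n. (1/2) ^ k * indicator {4 ^ k} n)"
      using P1_triangle[OF F, of "\<lambda>n. (1/2) ^ k * indicator {4 ^ k} n" k] by (simp add: Mplus_def)
    also have "\<rho> (\<lambda>n. (1/2) ^ k * indicator {4 ^ k} n) = ennreal ((1/2) ^ k) * \<rho> (indicator {4 ^ k})"
      by (intro P1_scale indicator_Mplus) simp
    also have "\<dots> = ennreal ((1/2) ^ k * u)"
      unfolding rho_unit[of "4 ^ k"] u(1) using u(2) by (intro ennreal_mult[symmetric]) simp_all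
    also have "\<rho> (F k) + \<dots> \<le> ennreal ((\<Sum>j<k. (1/2) ^ j) * u) + ennreal ((1/2) ^ k * u)"
      by (intro add_right_mono Suc)
    also have "\<dots> = ennreal ((\<Sum>j<k. (1/2) ^ j) * u + (1/2) ^ k * u)"
      using u(2) by (intro ennreal_plus[symmetric]) (simp_all add: sum_nonneg)
    also have "(\<Sum>j<k. (1/2) ^ j) * u + (1/2) ^ k * u = (\<Sum>j<Suc k. (1/2) ^ j) * u"
      by (simp add: distrib_right)
    finally show ?case .
  qed
  have "(\<Sum>j<k. (1/2) ^ j) * u \<le> 2 * u" for k
    using u(2) by (intro mult_right_mono) (simp_all add: sum_gp_strict)
  then have F_le': "\<rho> (F k) \<le> ennreal (2 * u)" for k
    by (rule order_trans[OF F_le ennreal_leI])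
  have "(\<lambda>k. F k n) \<longlonglongrightarrow> f n" for n
    unfolding F_def f_def by (rule summable_LIMSEQ[OF summable])
  then have "\<rho> f \<le> ennreal (2 * u)"
    by (rule rho_le_if_pointwise_limit[OF F _ F_le'])
  moreover have f_nonneg: "0 \<le> f n" for n
    by (simp add: f_def suminf_nonneg summable s_nonneg)
  ultimately have "(\<lambda>n. of_real (f n)) \<in> bfs \<rho>"
    using u(2) by (intro bfs_normI(1)[of _ "2 * u"]) simp_all
  moreover have "(1/2) ^ j \<le> cmod (of_real (f (4 ^ j)))" for j
  proof -
    have "(\<Sum>i\<in>{j}. s (4 ^ j) i) \<le> f (4 ^ j)"
      unfolding f_def by (rule sum_le_suminf[OF summable]) (simp_all add: s_nonneg)
    then show ?thesis
      using f_nonneg by (simp add: s_def)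
  qed
  ultimately show ?thesis
    by (intro bexI[of _ "\<lambda>n. of_real (f n)"] allI)
qed

text \<open>If \<open>w = cesaro t x\<close> with \<open>x\<close> in the space, then \<open>geo t x\<close> is in the space and has the coordinates
  \<open>(n+1) * w n\<close>. Coordinates of elements of the space are bounded, whereas for the sparse sequence
  above these are at least \<open>2\<^sup>j\<close> at the indices \<open>4\<^sup>j\<close>. Exhibiting a sequence outside the range
  replaces an appeal to the open mapping theorem.\<close>

lemma cesaro_not_surj:
  assumes t: "0 \<le> t" "t < 1"
  shows "cesaro t ` bfs \<rho> \<noteq> bfs \<rho>"
proof
  assume surj: "cesaro t ` bfs \<rho> = bfs \<rho>"
  obtain u where u: "\<rho> (indicator {0}) = ennreal u" "0 < u"
    using rho_unit_real by blast
  obtain w where "w \<in> bfs \<rho>" and w: "\<forall>j. (1/2) ^ j \<le> cmod (w (4 ^ j))"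
    using ex_sparse_geometric by blast
  then have "w \<in> cesaro t ` bfs \<rho>"
    by (simp only: surj)
  then obtain x where x: "x \<in> bfs \<rho>" "w = cesaro t x"
    by blast
  define g where "g = geo (of_real t) x"
  have g: "g \<in> bfs \<rho>"
    unfolding g_def by (intro geo_bfs x t)
  have "2 ^ j * u \<le> bfs_norm \<rho> g" for j :: nat
  proof -
    have "(2 ^ j :: real) = (1/2) ^ j * 4 ^ j"
      by (simp flip: power_mult_distrib)
    also have "\<dots> \<le> (1/2) ^ j * real (4 ^ j + 1)"
      by (intro mult_left_mono) simp_all
    also have "\<dots> \<le> cmod (g (4 ^ j))"
    proof -
      have "cmod (w (4 ^ j)) = cmod (g (4 ^ j)) / real (4 ^ j + 1)"
        by (simp only: x(2) cesaro_eq_geo g_def norm_divide norm_of_nat)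
      then have "(1/2) ^ j \<le> cmod (g (4 ^ j)) / real (4 ^ j + 1)"
        using w by metis
      then show ?thesis
        by (subst (asm) pos_le_divide_eq) (simp_all add: add_pos_pos)
    qed
    finally have "2 ^ j * u \<le> cmod (g (4 ^ j)) * u"
      using u(2) by (intro mult_right_mono) simp_all
    also have "\<dots> \<le> bfs_norm \<rho> g"
    proof -
      have "ennreal (cmod (g (4 ^ j)) * u) \<le> ennreal (bfs_norm \<rho> g)"
        using coord_le_rho[OF abs_Mplus, of g "4 ^ j"] u(2)
        unfolding rho_unit[of "4 ^ j"] u(1) rho_eq_bfs_norm[OF g]
        by (simp add: ennreal_mult)
      then show ?thesis by simp
    qed
    finally show ?thesis .
  qed
  moreover obtain j where "bfs_norm \<rho> g / u < 2 ^ j"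
    using real_arch_pow[of 2 "bfs_norm \<rho> g / u"] by auto
  then have "bfs_norm \<rho> g < 2 ^ j * u"
    using u(2) by (simp add: pos_divide_less_eq)
  ultimately show False
    by (meson not_le)
qed

text \<open>A finitely supported sequence has a finitely supported preimage, and separability makes
  finitely supported sequences dense.\<close>

lemma cesaro_dense_range:
  assumes sep: "separable_space (bfs_top \<rho>)" and t: "0 \<le> t" "t < 1"
  shows "bfs_top \<rho> closure_of (cesaro t ` bfs \<rho>) = bfs \<rho>"
proof -
  interpret Metric_space "bfs \<rho>" "bfs_dist \<rho>"
    by (rule Metric_space_bfs)
  have trunc_range: "trunc N x \<in> cesaro t ` bfs \<rho>" for N x
  proof
    let ?y = "resolvent t 0 (trunc N x)"
    show "trunc N x = cesaro t ?y"
      using shifted_resolvent[OF zero_notin_Lambda, of t "trunc N x"] by (simp add: shifted_def)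
    have "forward_subst t 0 (trunc N x) n = 0" if "N \<le> n" for n
      using that by (cases n) (simp_all add: trunc_def)
    then have "?y = trunc (Suc N) ?y"
      by (auto simp: fun_eq_iff trunc_def[of "Suc N"] resolvent_def ungeo_def shift_def split: nat.split)
    then show "?y \<in> bfs \<rho>"
      by (metis trunc_bfs)
  qed
  have "\<exists>y\<in>cesaro t ` bfs \<rho>. y \<in> mball x e" if "x \<in> bfs \<rho>" "0 < e" for x e
  proof -
    obtain N where "bfs_dist \<rho> x (trunc N x) < e"
      using order_continuous_norm_if_separable[OF sep \<open>x \<in> bfs \<rho>\<close> \<open>0 < e\<close>] by blast
    then have "trunc N x \<in> mball x e"
      unfolding in_mball using that(1) trunc_bfs by blast
    then show ?thesis
      using trunc_range by blast
  qed
  then have "mtopology closure_of (cesaro t ` bfs \<rho>) = bfs \<rho>"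
    unfolding metric_closure_of by blast
  then show ?thesis
    by (simp only: bfs_top_def)
qed

text \<open>Off \<open>Lambda\<close> there is an algebraic inverse, and on \<open>Lambda\<close> the eigenvectors lie in the space.\<close>

lemma inj_iff_not_Lambda:
  assumes t: "0 \<le> t" "t < 1"
  shows "inj_on (shifted (cesaro t) l) (bfs \<rho>) \<longleftrightarrow> l \<notin> Lambda"
proof
  show "inj_on (shifted (cesaro t) l) (bfs \<rho>)" if "l \<notin> Lambda"
    by (rule inj_on_inverseI[of _ "resolvent t l"]) (rule resolvent_shifted[OF that])
  show "l \<notin> Lambda" if inj: "inj_on (shifted (cesaro t) l) (bfs \<rho>)"
  proof
    assume "l \<in> Lambda"
    then obtain m where l: "l = 1 / of_nat (m + 1)"
      by (auto simp: Lambda_def)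
    have "(\<lambda>n. 0 * eigenvector t m n) \<in> bfs \<rho>"
      by (intro bfs_scale eigenvector_bfs t)
    moreover have "shifted (cesaro t) l (\<lambda>n. 0) = (\<lambda>n. 0)"
      using cesaro_scale[of t 0 "\<lambda>_. 0"] by (simp add: shifted_def)
    ultimately have "eigenvector t m = (\<lambda>_. 0)"
      using inj_onD[OF inj _ eigenvector_bfs[OF t]] shifted_eigenvector by (simp add: l)
    then have "eigenvector t m m = 0"
      by simp
    then show False
      by (simp add: eigenvector_def)
  qed
qed

lemma range_shifted:
  assumes l: "l \<notin> Lambda" "l \<noteq> 0" and t: "0 \<le> t" "t < 1"
  shows "shifted (cesaro t) l ` bfs \<rho> = bfs \<rho>"
proof (intro equalityI subsetI)
  fix y assume "y \<in> shifted (cesaro t) l ` bfs \<rho>"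
  then obtain x where "x \<in> bfs \<rho>" "y = (\<lambda>n. cesaro t x n - l * x n)"
    unfolding shifted_def by blast
  then show "y \<in> bfs \<rho>"
    using bfs_diff[OF cesaro_tail(1)[OF _ t] bfs_scale] by blast
next
  fix y assume "y \<in> bfs \<rho>"
  then have "resolvent t l y \<in> bfs \<rho>"
    by (rule bounded_ops_maps[OF resolvent_bounded_op[OF l t]])
  then show "y \<in> shifted (cesaro t) l ` bfs \<rho>"
    by (rule rev_image_eqI) (simp add: shifted_resolvent[OF l(1)])
qed

lemma closure_of_range_shifted:
  assumes "separable_space (bfs_top \<rho>)" "l \<notin> Lambda" "0 \<le> t" "t < 1"
  shows "bfs_top \<rho> closure_of (shifted (cesaro t) l ` bfs \<rho>) = bfs \<rho>"
proof (cases "l = 0")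
  case True
  then show ?thesis using cesaro_dense_range assms by simp
next
  case False
  then show ?thesis
    using range_shifted[OF assms(2) False assms(3,4)] closure_of_topspace[of "bfs_top \<rho>"] by simp
qed

lemma spectrum_cesaro:
  assumes t: "0 \<le> t" "t < 1"
  shows "spectrum \<rho> (cesaro t) = Lambda \<union> {0}"
proof (intro equalityI subsetI)
  fix l assume l: "l \<in> spectrum \<rho> (cesaro t)"
  show "l \<in> Lambda \<union> {0}"
  proof (rule ccontr)
    assume "l \<notin> Lambda \<union> {0}"
    then have "l \<notin> Lambda" "l \<noteq> 0"
      by auto
    then have "\<exists>S\<in>bounded_ops \<rho>. \<forall>x\<in>bfs \<rho>.
        S (shifted (cesaro t) l x) = x \<and> shifted (cesaro t) l (S x) = x"
      using resolvent_bounded_op[OF _ _ t] shifted_resolvent resolvent_shifted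
      by (intro bexI[of _ "resolvent t l"]) blast+
    with l show False
      unfolding spectrum_def by blast
  qed
next
  fix l assume l: "l \<in> Lambda \<union> {0}"
  show "l \<in> spectrum \<rho> (cesaro t)"
  proof (rule ccontr)
    assume "l \<notin> spectrum \<rho> (cesaro t)"
    then obtain S where S: "S \<in> bounded_ops \<rho>" and inverse: "\<forall>x\<in>bfs \<rho>.
        S (shifted (cesaro t) l x) = x \<and> shifted (cesaro t) l (S x) = x"
      unfolding spectrum_def by blast
    have "inj_on (shifted (cesaro t) l) (bfs \<rho>)"
      using inverse by (intro inj_on_inverseI[of _ S]) blast
    then have "l = 0"
      using l inj_iff_not_Lambda[OF t] by auto
    have "x \<in> cesaro t ` bfs \<rho>" if "x \<in> bfs \<rho>" for x
    proof (rule image_eqI)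
      show "S x \<in> bfs \<rho>"
        by (rule bounded_ops_maps[OF S that])
      show "x = cesaro t (S x)"
        using inverse that \<open>l = 0\<close> by simp
    qed
    moreover have "cesaro t ` bfs \<rho> \<subseteq> bfs \<rho>"
      using cesaro_tail(1)[OF _ t] by blast
    ultimately show False
      using cesaro_not_surj[OF t] by blast
  qed
qed

lemma fine_spectra_cesaro:
  assumes sep: "separable_space (bfs_top \<rho>)" and t: "0 \<le> t" "t < 1"
  shows "point_spectrum \<rho> (cesaro t) = Lambda"
    and "continuous_spectrum \<rho> (cesaro t) = {0}"
    and "residual_spectrum \<rho> (cesaro t) = {}"
proof -
  note inj = inj_iff_not_Lambda[OF t]
  show "point_spectrum \<rho> (cesaro t) = Lambda"
    by (simp add: point_spectrum_def inj)
  show "residual_spectrum \<rho> (cesaro t) = {}"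
    using closure_of_range_shifted[OF sep _ t] unfolding residual_spectrum_def inj by blast
  have "l \<in> continuous_spectrum \<rho> (cesaro t) \<longleftrightarrow> l = 0" for l
  proof (cases "l = 0")
    case True
    then show ?thesis
      using cesaro_not_surj[OF t] cesaro_dense_range[OF sep t] zero_notin_Lambda
      by (simp add: continuous_spectrum_def inj)
  next
    case False
    then show ?thesis
      using range_shifted[OF _ False t] by (auto simp only: continuous_spectrum_def inj mem_Collect_eq)
  qed
  then show "continuous_spectrum \<rho> (cesaro t) = {0}"
    by blast
qed

end

theorem theorem3p9:
  fixes \<rho> :: "(nat \<Rightarrow> real) \<Rightarrow> ennreal" and t :: real
  assumes "function_norm \<rho>"
    and "rearrangement_invariant \<rho>"
    and "separable_space (bfs_top \<rho>)"
    and "0 \<le> t" and "t < 1"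
  shows "cesaro t \<in> bounded_ops \<rho> \<and>
         op_norm \<rho> (cesaro t) \<le> ennreal (1 / (1 - t)) \<and>
         compact_op \<rho> (cesaro t) \<and>
         spectrum \<rho> (cesaro t) = Lambda \<union> {0} \<and>
         point_spectrum \<rho> (cesaro t) = Lambda \<and>
         continuous_spectrum \<rho> (cesaro t) = {0} \<and>
         residual_spectrum \<rho> (cesaro t) = {}"
proof -
  interpret ri_function_norm \<rho>
    by (intro ri_function_norm.intro ri_function_norm_axioms.intro assms)
  show ?thesis
    by (intro conjI cesaro_bounded_op cesaro_op_norm_le cesaro_compact spectrum_cesaro
        fine_spectra_cesaro assms(3-5))
qed

end
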